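(* Let $d\ge 1$ be a real number. For every real $\xi>0$ there exists $N$ (depending on $\xi$ and $d$) such that for all integers $n\ge N$ and all integers $k$ with $1\le k\leq (\ln n)^{d}$ the following holds: if $\mathcal{F}\subset \mathrm{Sym}(n,k)$ is a non-centred intersecting family, then \[|\mathcal{F}| \leq \left(1-\frac{1}{e} +\xi\right)\cdot \max\left\{ \mathrm{c}(n-1,k),\ \mathrm{c}(n-1,k-1) \right\}.\]
   Context: $[n]=\{1,\dots,n\}$; $\mathrm{Sym}(n)$ is the set of all permutations of $[n]$. $\mathrm{Sym}(n,k)$ is the set of permutations in $\mathrm{Sym}(n)$ with exactly $k$ cycles in their cycle decomposition (fixed points count as cycles). $\mathrm{c}(m,l)$ is the unsigned Stirling number of the first kind, i.e. the number of permutations of $[m]$ with exactly $l$ cycles; in particular $\mathrm{c}(m,0)=0$ for $m>0$. A family $\mathcal{F}\subset\mathrm{Sym}(n,k)$ is intersecting if for all $\sigma,\tau\in\mathcal{F}$ there is $i\in[n]$ with $\sigma(i)=\tau(i)$. A star in $\mathrm{Sym}(n,k)$ is a family of the form $\{\sigma\in\mathrm{Sym}(n,k): \sigma(i)=j\}$ with $i,j\in[n]$. An intersecting family is centred if it is contained in a star, and non-centred otherwise. *)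

theory Defs
  imports Complex_Main "HOL-Combinatorics.Orbits"
begin

text \<open>
  A permutation of \<open>[n]\<close> is a function on \<open>nat\<close> that \<open>permutes {1..n}\<close>, hence is the
  identity outside \<open>{1..n}\<close>; only orbits of points of \<open>{1..n}\<close> are counted as cycles.
  A fixed point \<open>i\<close> contributes the orbit \<open>{i}\<close>.
\<close>

definition num_cycles :: "nat \<Rightarrow> (nat \<Rightarrow> nat) \<Rightarrow> nat" where
  "num_cycles n \<sigma> = card (orbit \<sigma> ` {1..n})"

definition Sym :: "nat \<Rightarrow> (nat \<Rightarrow> nat) set" where
  "Sym n = {\<sigma>. \<sigma> permutes {1..n}}"

definition Sym_cycles :: "nat \<Rightarrow> nat \<Rightarrow> (nat \<Rightarrow> nat) set" where
  "Sym_cycles n k = {\<sigma> \<in> Sym n. num_cycles n \<sigma> = k}"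

text \<open>
  The unsigned Stirling number of the first kind in its combinatorial definition, rather than
  through the recurrence that defines \<open>stirling\<close> in \<open>HOL-Combinatorics.Stirling\<close>.
\<close>

definition cycle_number :: "nat \<Rightarrow> nat \<Rightarrow> nat" where
  "cycle_number m l = card (Sym_cycles m l)"

definition intersecting_family :: "nat \<Rightarrow> nat \<Rightarrow> (nat \<Rightarrow> nat) set \<Rightarrow> bool" where
  "intersecting_family n k F \<longleftrightarrow>
     F \<subseteq> Sym_cycles n k \<and> (\<forall>\<sigma>\<in>F. \<forall>\<tau>\<in>F. \<exists>i\<in>{1..n}. \<sigma> i = \<tau> i)"

definition perm_star :: "nat \<Rightarrow> nat \<Rightarrow> nat \<Rightarrow> nat \<Rightarrow> (nat \<Rightarrow> nat) set" where
  "perm_star n k i j = {\<sigma> \<in> Sym_cycles n k. \<sigma> i = j}"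

definition centred_family :: "nat \<Rightarrow> nat \<Rightarrow> (nat \<Rightarrow> nat) set \<Rightarrow> bool" where
  "centred_family n k F \<longleftrightarrow> (\<exists>i\<in>{1..n}. \<exists>j\<in>{1..n}. F \<subseteq> perm_star n k i j)"

end

(*  Spread approximation with elementary ingredients. A family of permutations, viewed as sets of
    arcs (p, sigma p), is r-spread if prescribing X costs a factor of r^|X|. Greedily splitting off
    dense links with r = n/16 covers all but a negligible part of F by few-arc sets B whose links
    inside F are spread. Two spread families of n-sets contain disjoint members as soon as r is a
    small constant times n: colour the arcs with four colours; with two colours one finds members of
    the first family, with the other two members of the second. Here one colour class W reduces a
    typical member to a fragment of size at most w = n/1000 outside W (an encoding argument), and
    spread fragments that are much smaller than r are swallowed by a second colour class (second
    moment). Hence the sets B are pairwise intersecting. Either they share an arc, so that F almost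
    lies in a star, or every member of F outside the negligible part contains one of few pairs of
    arcs. In the first case some sigma in F is outside the star, all members of F meet sigma, and
    Bonferroni's inequality shows that a proportion of about 1/e of the star avoids sigma: since sigma
    has few cycles, almost all sets of j arcs of sigma are acyclic, and fixing acyclic arcs is a
    contraction, leaving a Stirling number with the same number of cycles. *)

theory Submission
  imports Defs "HOL-Combinatorics.Stirling" "HOL-Analysis.Convex" "HOL-Real_Asymp.Real_Asymp"
begin

section \<open>Permutations with prescribed arcs and number of cycles\<close>

text \<open>The obstacle is that spreadness is measured against all permutations of [n], whereas the
  target is a Stirling number. The uncovered remainder is only known to be at most n!/4^q up to a
  constant, and n! may exceed the target by a factor of up to n^(k+1); hence q has to dominate k ln
  n. The alternative with few pairs of arcs costs a factor q^2 k^2 / n, so q k has to be small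
  against the square root of n. For polylogarithmic k, q about n^(1/4) leaves room on both sides.
  The fragment size w is squeezed in the same way: the encoding needs r^w to beat 8^n, the second
  moment needs w/r to be small. A small multiple of n meets both demands, because r is linear in n
  and ln r tends to infinity. The maximum in the target is the size of a largest star: i = j leaves
  k - 1 cycles on n - 1 points, i \<noteq> j leaves k.\<close>

definition cycles_on :: "'a set \<Rightarrow> ('a \<Rightarrow> 'a) \<Rightarrow> nat" where
  "cycles_on V \<sigma> = card (orbit \<sigma> ` V)"

definition cycle_perms :: "'a set \<Rightarrow> nat \<Rightarrow> ('a \<Rightarrow> 'a) set" where
  "cycle_perms V k = {\<tau>. \<tau> permutes V \<and> cycles_on V \<tau> = k}"

text \<open>A set of arcs is encoded as the restriction of a permutation \<open>\<sigma>\<close> to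
  a set \<open>D\<close> of starting points. Contracting an arc then acts on the pair of
  \<open>D\<close> and \<open>\<sigma>\<close>.\<close>

definition agreeing :: "'a set \<Rightarrow> nat \<Rightarrow> 'a set \<Rightarrow> ('a \<Rightarrow> 'a) \<Rightarrow> ('a \<Rightarrow> 'a) set" where
  "agreeing V k D \<sigma> = {\<tau> \<in> cycle_perms V k. \<forall>p\<in>D. \<tau> p = \<sigma> p}"

section \<open>Cycle counts under deletion of points and contraction of arcs\<close>

lemma finite_cycle_perms: "finite V \<Longrightarrow> finite (cycle_perms V k)"
  by (rule finite_subset[OF _ finite_permutations]) (auto simp: cycle_perms_def)

lemma permutes_self_in_orbit: "finite V \<Longrightarrow> \<sigma> permutes V \<Longrightarrow> x \<in> orbit \<sigma> x"
  by (rule permutation_self_in_orbit) (auto simp: permutation_permutes)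

lemma orbit_eq_of_mem: "finite V \<Longrightarrow> \<sigma> permutes V \<Longrightarrow> y \<in> orbit \<sigma> x \<Longrightarrow> orbit \<sigma> y = orbit \<sigma> x"
  by (rule orbit_cyclic_eq3[OF cyclic_on_orbit])

text \<open>The transposition short-circuits \<open>d\<close>: the arc that ended in
  \<open>d\<close> now ends in \<open>\<sigma> d\<close>, and \<open>d\<close> becomes a fixed
  point. All other points keep their cyclic order.\<close>

lemma orbit_transpose_comp:
  assumes "finite V" "\<sigma> permutes V" "\<sigma> d \<noteq> d" "x \<noteq> d"
  shows "orbit (transpose d (\<sigma> d) \<circ> \<sigma>) x = orbit \<sigma> x - {d}"
proof -
  let ?s = "transpose d (\<sigma> d) \<circ> \<sigma>"
  have inj: "inj \<sigma>" using assms(2) permutes_inj by blast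
  have v: "?s y = (if \<sigma> y = d then \<sigma> d else \<sigma> y)" if "y \<noteq> d" for y
    using that inj assms(3) by (auto simp: transpose_def dest: injD)
  have ne: "?s y \<noteq> d" if "y \<noteq> d" for y
    using assms(3) unfolding v[OF that] by simp
  have A: "y \<in> orbit \<sigma> x \<and> y \<noteq> d" if "y \<in> orbit ?s x" for y
    using that
  proof induction
    case base
    show ?case using v[OF assms(4)] ne[OF assms(4)]
      by (metis orbit.base orbit.step)
  next
    case (step y)
    then show ?case using v[of y] ne[of y] by (metis orbit.step)
  qed
  have B: "(y \<noteq> d \<longrightarrow> y \<in> orbit ?s x) \<and> (y = d \<longrightarrow> \<sigma> d \<in> orbit ?s x)" if "y \<in> orbit \<sigma> x" for y
    using that
  proof induction
    case base
    show ?case using v[OF assms(4)] by (metis orbit.base)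
  next
    case (step y)
    show ?case
    proof (cases "y = d")
      case True
      then show ?thesis using step assms(3) by auto
    next
      case False
      then show ?thesis using step v[of y] orbit.step[of y ?s x] by metis
    qed
  qed
  show ?thesis using A B by blast
qed

lemma cycles_on_fixed_point:
  assumes "finite V" "\<tau> permutes V" "d \<in> V" "\<tau> d = d"
  shows "cycles_on V \<tau> = Suc (cycles_on (V - {d}) \<tau>)"
proof -
  have "orbit \<tau> d = {d}" using assms(4) orbit_eq_singleton_iff by metis
  then have "orbit \<tau> ` V = insert {d} (orbit \<tau> ` (V - {d}))"
    using assms(3) by auto
  moreover have "{d} \<notin> orbit \<tau> ` (V - {d})"
    using permutes_self_in_orbit[OF assms(1,2)] by force
  ultimately show ?thesis
    using assms(1) by (simp add: cycles_on_def)
qed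

text \<open>Short-circuiting splits \<open>{d}\<close> off its cycle. As
  \<open>\<sigma> d \<noteq> d\<close>, something of that cycle remains, so removing
  \<open>d\<close> is injective on the cycles of \<open>\<sigma>\<close>, and \<open>{d}\<close> is
  the only new one.\<close>

lemma cycles_on_transpose_comp:
  assumes "finite V" "\<sigma> permutes V" "d \<in> V" "\<sigma> d \<noteq> d"
  shows "cycles_on V (transpose d (\<sigma> d) \<circ> \<sigma>) = Suc (cycles_on V \<sigma>)"
proof -
  let ?s = "transpose d (\<sigma> d) \<circ> \<sigma>" and ?f = "\<lambda>P. P - {d}"
  have sV: "\<sigma> d \<in> V" using assms(2,3) by (simp add: permutes_in_image)
  have d: "orbit ?s d = {d}" using orbit_eq_singleton_iff[of ?s d] by simp
  have o: "orbit ?s x = orbit \<sigma> x - {d}" if "x \<noteq> d" for x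
    using orbit_transpose_comp[OF assms(1,2,4) that] .
  \<comment> \<open>The cycle of \<open>d\<close> is also the cycle of \<open>\<sigma> d\<close>, so
    it is not lost when the point \<open>d\<close> is left out of the image.\<close>
  have od: "orbit \<sigma> (\<sigma> d) = orbit \<sigma> d"
    by (rule orbit_eq_of_mem[OF assms(1,2) orbit.base])
  have "orbit ?s ` V = insert {d} (?f ` orbit \<sigma> ` V)"
  proof -
    have "orbit ?s ` V = insert {d} (orbit ?s ` (V - {d}))"
      using d assms(3) by (metis image_insert insert_Diff)
    also have "orbit ?s ` (V - {d}) = ?f ` orbit \<sigma> ` (V - {d})"
      unfolding image_image using o by (intro image_cong) auto
    also have "orbit \<sigma> ` (V - {d}) = orbit \<sigma> ` V"
    proof -
      have "orbit \<sigma> d \<in> orbit \<sigma> ` (V - {d})" using od sV assms(4) by (intro image_eqI[of _ _ "\<sigma> d"]) auto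
      then show ?thesis using assms(3) by auto
    qed
    finally show ?thesis .
  qed
  moreover have ne: "\<exists>y. y \<in> P \<and> y \<noteq> d" if "P \<in> orbit \<sigma> ` V" for P
  proof -
    obtain x where x: "P = orbit \<sigma> x" using \<open>P \<in> _\<close> by blast
    show ?thesis
    proof (cases "x = d")
      case True
      then show ?thesis using x assms(4) orbit.base by metis
    next
      case False
      then show ?thesis using x permutes_self_in_orbit[OF assms(1,2)] by metis
    qed
  qed
  moreover have "inj_on ?f (orbit \<sigma> ` V)"
  proof (rule inj_onI)
    fix P Q assume P: "P \<in> orbit \<sigma> ` V" and Q: "Q \<in> orbit \<sigma> ` V" and e: "P - {d} = Q - {d}"
    obtain y where "y \<in> P" "y \<noteq> d" using ne[OF P] by auto
    then have "y \<in> P" "y \<in> Q" using e by auto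
    moreover obtain x z where "P = orbit \<sigma> x" "Q = orbit \<sigma> z" using P Q by blast
    ultimately show "P = Q" using orbit_eq_of_mem[OF assms(1,2)] by metis
  qed
  moreover have "{d} \<notin> ?f ` orbit \<sigma> ` V" by auto
  ultimately show ?thesis
    using assms(1) by (simp add: cycles_on_def card_image)
qed

lemma permutes_remove_fixed_point:
  assumes "\<tau> permutes V" "\<tau> d = d" shows "\<tau> permutes (V - {d})"
  by (rule permutes_superset[OF assms(1)]) (use assms(2) in auto)

lemma transpose_comp_permutes_remove:
  assumes "\<sigma> permutes V" "d \<in> V"
  shows "transpose d (\<sigma> d) \<circ> \<sigma> permutes (V - {d})"
proof (rule permutes_remove_fixed_point)
  show "transpose d (\<sigma> d) \<circ> \<sigma> permutes V"
    using assms by (intro permutes_compose permutes_swap_id) (auto simp: permutes_in_image)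
qed simp

lemma cycle_perms_remove_fixed_point:
  assumes "finite V" "d \<in> V" "\<tau> d = d"
  shows "\<tau> \<in> cycle_perms V (Suc k) \<longleftrightarrow> \<tau> \<in> cycle_perms (V - {d}) k"
proof (cases "\<tau> permutes V")
  case True
  then show ?thesis
    using permutes_remove_fixed_point[OF True assms(3)] cycles_on_fixed_point[OF assms(1) True assms(2,3)]
    by (simp add: cycle_perms_def)
next
  case False
  then have "\<not> \<tau> permutes (V - {d})" using permutes_subset[of \<tau> "V - {d}" V] by blast
  then show ?thesis using False by (simp add: cycle_perms_def)
qed

lemma cycle_perms_fixes: "\<tau> \<in> cycle_perms (V - {d}) k \<Longrightarrow> \<tau> d = d"
  unfolding cycle_perms_def by (auto intro: permutes_not_in[of \<tau> "V - {d}"])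

text \<open>A prescribed loop is a complete cycle. Deleting it uses up one of the \<open>k\<close>
  cycles, which is impossible for \<open>k = 0\<close>.\<close>

lemma agreeing_remove_fixed_point:
  assumes "finite V" "d \<in> V" "d \<in> D" "\<sigma> d = d"
  shows "agreeing V (Suc k) D \<sigma> = agreeing (V - {d}) k (D - {d}) \<sigma>"
    and "agreeing V 0 D \<sigma> = {}"
proof -
  show "agreeing V (Suc k) D \<sigma> = agreeing (V - {d}) k (D - {d}) \<sigma>"
  proof (intro set_eqI iffI)
    fix \<tau> assume "\<tau> \<in> agreeing V (Suc k) D \<sigma>"
    then have "\<tau> \<in> cycle_perms V (Suc k)" "\<forall>p\<in>D. \<tau> p = \<sigma> p" by (auto simp: agreeing_def)
    moreover from this have "\<tau> d = d" using assms(3,4) by simp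
    ultimately show "\<tau> \<in> agreeing (V - {d}) k (D - {d}) \<sigma>"
      using cycle_perms_remove_fixed_point[OF assms(1,2)] by (simp add: agreeing_def)
  next
    fix \<tau> assume "\<tau> \<in> agreeing (V - {d}) k (D - {d}) \<sigma>"
    then have "\<tau> \<in> cycle_perms (V - {d}) k" "\<forall>p\<in>D - {d}. \<tau> p = \<sigma> p" by (auto simp: agreeing_def)
    moreover from this have "\<tau> d = d" using cycle_perms_fixes by metis
    ultimately show "\<tau> \<in> agreeing V (Suc k) D \<sigma>"
      using cycle_perms_remove_fixed_point[OF assms(1,2)] assms(4) by (auto simp: agreeing_def)
  qed
  have False if "\<tau> \<in> agreeing V 0 D \<sigma>" for \<tau>
  proof -
    have "\<tau> permutes V" "cycles_on V \<tau> = 0" "\<tau> d = d"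
      using that assms(3,4) by (auto simp: agreeing_def cycle_perms_def)
    then show False using cycles_on_fixed_point[OF assms(1) _ assms(2)] by simp
  qed
  then show "agreeing V 0 D \<sigma> = {}" by blast
qed

text \<open>Every \<open>\<tau>\<close> in question shares the arc of \<open>\<sigma>\<close> at
  \<open>d\<close>, so one and the same transposition short-circuits \<open>d\<close> in all of
  them. The cycle through \<open>d\<close> has other points and survives; hence \<open>k\<close>
  does not change, and agreement at the remaining points is preserved because transpositions are
  injective.\<close>

lemma agreeing_contract:
  assumes "finite V" "\<sigma> permutes V" "d \<in> V" "d \<in> D" "\<sigma> d \<noteq> d"
  shows "bij_betw (\<lambda>\<tau>. transpose d (\<sigma> d) \<circ> \<tau>) (agreeing V k D \<sigma>)
           (agreeing (V - {d}) k (D - {d}) (transpose d (\<sigma> d) \<circ> \<sigma>))"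
proof -
  let ?t = "transpose d (\<sigma> d)"
  have sV: "\<sigma> d \<in> V" using assms(2,3) by (simp add: permutes_in_image)
  have tp: "?t permutes V" using assms(3) sV by (rule permutes_swap_id)
  have tt: "?t \<circ> (?t \<circ> \<tau>) = \<tau>" for \<tau>
    by (simp add: fun_eq_iff)
  have agr: "(\<forall>p\<in>D. \<tau> p = \<sigma> p) \<longleftrightarrow> \<tau> d = \<sigma> d \<and> (\<forall>p\<in>D - {d}. (?t \<circ> \<tau>) p = (?t \<circ> \<sigma>) p)" for \<tau>
  proof -
    have "?t x = ?t y \<longleftrightarrow> x = y" for x y by (metis transpose_involutory)
    then show ?thesis using assms(4) by auto
  qed
  have cp: "\<tau> \<in> cycle_perms V k \<longleftrightarrow> ?t \<circ> \<tau> \<in> cycle_perms (V - {d}) k" if td: "\<tau> d = \<sigma> d" for \<tau>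
  proof -
    have p: "\<tau> permutes V \<longleftrightarrow> ?t \<circ> \<tau> permutes V"
      using permutes_compose[OF _ tp, of \<tau>] permutes_compose[OF _ tp, of "?t \<circ> \<tau>"] tt[of \<tau>] by metis
    have p2: "?t \<circ> \<tau> permutes V \<longleftrightarrow> ?t \<circ> \<tau> permutes (V - {d})"
      using permutes_remove_fixed_point[of "?t \<circ> \<tau>" V d] permutes_subset[of "?t \<circ> \<tau>" "V - {d}" V] td
      by auto
    have "cycles_on V \<tau> = cycles_on (V - {d}) (?t \<circ> \<tau>)" if "\<tau> permutes V"
    proof -
      have "cycles_on V (?t \<circ> \<tau>) = Suc (cycles_on V \<tau>)"
        using cycles_on_transpose_comp[OF assms(1) that assms(3)] assms(5) td by simp
      moreover have "cycles_on V (?t \<circ> \<tau>) = Suc (cycles_on (V - {d}) (?t \<circ> \<tau>))"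
        using p that td by (intro cycles_on_fixed_point[OF assms(1) _ assms(3)]) auto
      ultimately show ?thesis by simp
    qed
    then show ?thesis using p p2 by (auto simp: cycle_perms_def)
  qed
  have dfix: "(?t \<circ> \<tau>) d = \<sigma> d" if "\<tau> \<in> cycle_perms (V - {d}) k" for \<tau>
    using that permutes_not_in[of \<tau> "V - {d}" d] by (auto simp: cycle_perms_def)
  show ?thesis
  proof (rule bij_betw_byWitness[where f' = "\<lambda>\<tau>. ?t \<circ> \<tau>"])
    show "\<forall>a\<in>agreeing V k D \<sigma>. ?t \<circ> (?t \<circ> a) = a" using tt by blast
    show "\<forall>a\<in>agreeing (V - {d}) k (D - {d}) (?t \<circ> \<sigma>). ?t \<circ> (?t \<circ> a) = a" using tt by blast
    show "(\<lambda>\<tau>. ?t \<circ> \<tau>) ` agreeing V k D \<sigma> \<subseteq> agreeing (V - {d}) k (D - {d}) (?t \<circ> \<sigma>)"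
      unfolding agreeing_def using agr cp by blast
    show "(\<lambda>\<tau>. ?t \<circ> \<tau>) ` agreeing (V - {d}) k (D - {d}) (?t \<circ> \<sigma>) \<subseteq> agreeing V k D \<sigma>"
    proof
      fix \<tau> assume "\<tau> \<in> (\<lambda>\<tau>. ?t \<circ> \<tau>) ` agreeing (V - {d}) k (D - {d}) (?t \<circ> \<sigma>)"
      then obtain \<tau>' where t: "\<tau> = ?t \<circ> \<tau>'" "\<tau>' \<in> cycle_perms (V - {d}) k"
        "\<forall>p\<in>D - {d}. \<tau>' p = (?t \<circ> \<sigma>) p" by (auto simp: agreeing_def)
      have "\<tau>' = ?t \<circ> \<tau>" unfolding t(1) by (rule tt[symmetric])
      moreover have "\<tau> d = \<sigma> d" using dfix t by simp
      ultimately show "\<tau> \<in> agreeing V k D \<sigma>" unfolding agreeing_def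
        using agr[of \<tau>] cp[of \<tau>] t by simp
    qed
  qed
qed

text \<open>Split by the image \<open>b\<close> of the new point \<open>d\<close>;
  \<open>transpose d b\<close> serves as a permutation that sends \<open>d\<close> to
  \<open>b\<close>. The loop \<open>b = d\<close> is deleted, the other arcs are contracted, and the
  two cases are the two summands of the Stirling recurrence.\<close>

lemma card_cycle_perms:
  assumes "finite V" shows "card (cycle_perms V k) = stirling (card V) k"
  using assms
proof (induction V arbitrary: k rule: finite_induct)
  case empty
  have "cycle_perms ({} :: 'a set) k = (if k = 0 then {id} else {})" for k
    by (auto simp: cycle_perms_def cycles_on_def)
  from this[of k] show ?case by (cases k) simp_all
next
  case (insert d V)
  let ?W = "insert d V"
  have fW: "finite ?W" using insert by simp
  let ?P = "\<lambda>b. agreeing ?W k {d} (transpose d b)"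
  have un: "cycle_perms ?W k = (\<Union>b\<in>?W. ?P b)"
  proof -
    have "\<tau> d \<in> ?W" if "\<tau> \<in> cycle_perms ?W k" for \<tau>
      using that permutes_in_image[of \<tau> ?W d] by (auto simp: cycle_perms_def)
    then show ?thesis unfolding agreeing_def by auto
  qed
  have "card (cycle_perms ?W k) = (\<Sum>b\<in>?W. card (?P b))"
    unfolding un using fW finite_cycle_perms[OF fW, of k] by (intro card_UN_disjoint) (auto simp: agreeing_def)
  also have "\<dots> = card (?P d) + (\<Sum>b\<in>V. card (?P b))" using insert by simp
  also have "(\<Sum>b\<in>V. card (?P b)) = (\<Sum>b\<in>V. stirling (card V) k)"
  proof (rule sum.cong[OF refl])
    fix b assume b: "b \<in> V"
    have "card (?P b) = card (agreeing V k {} (transpose d b \<circ> transpose d b))"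
      using bij_betw_same_card[OF agreeing_contract[of ?W "transpose d b" d "{d}" k]] b insert
        permutes_swap_id[of d ?W b] by (cases "b = d") (auto simp: insert_Diff_if)
    then show "card (?P b) = stirling (card V) k" using insert by (simp add: agreeing_def)
  qed
  also have "card (?P d) = (case k of 0 \<Rightarrow> 0 | Suc k' \<Rightarrow> stirling (card V) k')"
  proof (cases k)
    case 0
    then show ?thesis using agreeing_remove_fixed_point(2)[of ?W d "{d}" "transpose d d"] insert
      by simp
  next
    case (Suc k')
    then show ?thesis using agreeing_remove_fixed_point(1)[of ?W d "{d}" "transpose d d" k'] insert
      by (simp add: agreeing_def)
  qed
  finally show ?case using insert stirling_0[of "card V"] by (cases k; cases "V = {}") (simp_all add: card_gt_0_iff)
qed

text \<open>Contract the arcs one by one. A cycle is spent only when an arc has become a loop, that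
  is, when \<open>D\<close> contains a whole cycle of \<open>\<sigma>\<close>; \<open>c\<close>
  counts these events. Without such a cycle the count is exactly a Stirling number with the same
  \<open>k\<close>.\<close>

lemma card_agreeing:
  assumes "finite V" "\<sigma> permutes V" "D \<subseteq> V"
  shows "\<exists>c \<le> card D. card (agreeing V k D \<sigma>) = (if c \<le> k then stirling (card V - card D) (k - c) else 0)
           \<and> (c \<noteq> 0 \<longrightarrow> (\<exists>x\<in>D. orbit \<sigma> x \<subseteq> D))"
proof -
  have "finite D" using assms finite_subset by blast
  then show ?thesis using assms
  proof (induction D arbitrary: V k \<sigma> rule: finite_induct)
    case empty
    then show ?case by (auto simp: agreeing_def card_cycle_perms)
  next
    case (insert d D)
    have cV: "card (V - {d}) - card D = card V - card (insert d D)"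
      using insert by (simp add: card_Diff_singleton)
    have DV: "D \<subseteq> V - {d}" "insert d D - {d} = D" "finite (V - {d})" "d \<in> V"
      using insert by auto
    show ?case
    proof (cases "\<sigma> d = d")
      case True
      have s: "\<sigma> permutes (V - {d})" using insert True permutes_remove_fixed_point by metis
      have ex: "\<exists>x\<in>insert d D. orbit \<sigma> x \<subseteq> insert d D"
        using True orbit_eq_singleton_iff[of \<sigma> d] by auto
      show ?thesis
      proof (cases k)
        case 0
        then have "card (agreeing V k (insert d D) \<sigma>) = 0"
          using agreeing_remove_fixed_point(2)[of V d "insert d D" \<sigma>] insert.prems True by simp
        then show ?thesis using 0 ex insert.hyps by (intro exI[of _ 1]) auto
      next
        case (Suc k')
        obtain c where c: "c \<le> card D" "card (agreeing (V - {d}) k' D \<sigma>) =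
            (if c \<le> k' then stirling (card (V - {d}) - card D) (k' - c) else 0)"
          using insert.IH[OF DV(3) s DV(1)] by metis
        have "agreeing V k (insert d D) \<sigma> = agreeing (V - {d}) k' D \<sigma>"
          using agreeing_remove_fixed_point(1)[of V d "insert d D" \<sigma> k'] insert.prems True DV Suc by simp
        then show ?thesis using c ex Suc insert.hyps cV by (intro exI[of _ "Suc c"]) auto
      qed
    next
      case False
      let ?s = "transpose d (\<sigma> d) \<circ> \<sigma>"
      have s: "?s permutes (V - {d})" using insert DV transpose_comp_permutes_remove by metis
      obtain c where c: "c \<le> card D" "card (agreeing (V - {d}) k D ?s) =
          (if c \<le> k then stirling (card (V - {d}) - card D) (k - c) else 0)"
          "c \<noteq> 0 \<longrightarrow> (\<exists>x\<in>D. orbit ?s x \<subseteq> D)"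
        using insert.IH[OF DV(3) s DV(1)] by metis
      have "card (agreeing V k (insert d D) \<sigma>) = card (agreeing (V - {d}) k D ?s)"
        using bij_betw_same_card[OF agreeing_contract[of V \<sigma> d "insert d D" k]] insert.prems False DV by simp
      moreover have "\<exists>x\<in>insert d D. orbit \<sigma> x \<subseteq> insert d D" if c0: "c \<noteq> 0"
      proof -
        obtain x where x: "x \<in> D" "orbit ?s x \<subseteq> D" using c(3) c0 by blast
        have "x \<noteq> d" using x(1) insert.hyps(2) by metis
        then have "orbit ?s x = orbit \<sigma> x - {d}"
          by (rule orbit_transpose_comp[OF insert.prems(1,2) False])
        then have "orbit \<sigma> x - {d} \<subseteq> D" using x(2) by simp
        then have "orbit \<sigma> x \<subseteq> insert d D" by (simp add: Diff_subset_conv)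
        then show ?thesis using x(1) by (intro bexI[of _ x]) simp_all
      qed
      ultimately show ?thesis using c insert.hyps cV by (intro exI[of _ c]) auto
    qed
  qed
qed

section \<open>Comparing neighbouring Stirling numbers\<close>

text \<open>The constant is the exact ratio on the diagonal \<open>m = Suc k\<close>. It increases
  with \<open>k\<close>, so the Stirling recurrence carries the inequality on to larger
  \<open>m\<close>.\<close>

lemma stirling_pred_le:
  assumes "Suc k \<le> m"
  shows "stirling m k \<le> (Suc k choose 2) * stirling m (Suc k)"
  using assms
proof (induction m arbitrary: k)
  case (Suc m)
  show ?case
  proof (cases "k = m")
    case True
    then show ?thesis by (simp add: stirling_Suc_n_n del: stirling.simps)
  next
    case False
    then have km: "Suc k \<le> m" using Suc.prems by simp
    show ?thesis
    proof (cases k)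
      case (Suc l)
      have mono: "(Suc l choose 2) \<le> (Suc k choose 2)" using Suc by (simp add: numeral_2_eq_2)
      have "stirling (Suc m) k = m * stirling m k + stirling m l" using Suc by simp
      also have "\<dots> \<le> m * ((Suc k choose 2) * stirling m (Suc k)) + (Suc l choose 2) * stirling m (Suc l)"
        using Suc.IH[OF km] Suc.IH[of l] km Suc by (intro add_mono mult_left_mono) auto
      also have "\<dots> \<le> m * ((Suc k choose 2) * stirling m (Suc k)) + (Suc k choose 2) * stirling m (Suc l)"
        using mono by (intro add_mono mult_right_mono) auto
      also have "\<dots> = (Suc k choose 2) * stirling (Suc m) (Suc k)"
        using Suc by (simp add: algebra_simps)
      finally show ?thesis .
    qed simp
  qed
qed simp

lemma stirling_pred_le_square:
  assumes "1 \<le> k" "k \<le> m" shows "stirling m (k - 1) \<le> k\<^sup>2 * stirling m k"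
proof -
  have "k choose 2 \<le> k\<^sup>2" by (simp add: choose_two power2_eq_square le_trans[OF div_le_dividend] mult_le_mono2)
  moreover obtain l where "k = Suc l" using assms by (cases k) auto
  ultimately show ?thesis using stirling_pred_le[of l m] assms
    by (metis diff_Suc_1 le_trans mult_le_mono1)
qed

lemma stirling_diff_le:
  assumes "c \<le> k" "k \<le> m" shows "stirling m (k - c) \<le> (k\<^sup>2) ^ c * stirling m k"
  using assms
proof (induction c)
  case (Suc c)
  have "stirling m (k - Suc c) \<le> (k - c)\<^sup>2 * stirling m (k - c)"
    using stirling_pred_le_square[of "k - c" m] Suc.prems by simp
  also have "\<dots> \<le> k\<^sup>2 * ((k\<^sup>2) ^ c * stirling m k)"
    using Suc by (intro mult_mono power_mono) auto
  finally show ?case by (simp add: algebra_simps)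
qed simp

lemma stirling_Suc_ge: "m * stirling m k \<le> stirling (Suc m) k"
  by (cases m; cases k) simp_all

text \<open>Together with \<open>stirling_Suc_ge\<close>: an additional point multiplies the count
  by a factor between \<open>m\<close> and \<open>m\<close> plus the square of \<open>k\<close>. For
  small \<open>k\<close> this is asymptotically \<open>m\<close>, whatever \<open>k\<close>
  is.\<close>

lemma stirling_Suc_le:
  assumes "k \<le> m" shows "stirling (Suc m) k \<le> (m + k\<^sup>2) * stirling m k"
proof (cases k)
  case (Suc l)
  then show ?thesis using stirling_pred_le_square[of k m] assms by (simp add: algebra_simps)
next
  case 0
  then show ?thesis by (cases m) simp_all
qed

lemma stirling_shift_ge: "m ^ j * stirling m k \<le> stirling (m + j) k"
proof (induction j)
  case (Suc j)
  have "m ^ Suc j * stirling m k \<le> (m + j) * (m ^ j * stirling m k)" by simp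
  also have "\<dots> \<le> (m + j) * stirling (m + j) k" using Suc by (rule mult_left_mono) simp
  also have "\<dots> \<le> stirling (m + Suc j) k" using stirling_Suc_ge[of "m + j" k] by simp
  finally show ?case .
qed simp

lemma stirling_shift_le:
  assumes "k \<le> m" shows "stirling (m + j) k \<le> (m + j + k\<^sup>2) ^ j * stirling m k"
proof (induction j)
  case (Suc j)
  have "stirling (m + Suc j) k \<le> (m + j + k\<^sup>2) * stirling (m + j) k"
    using stirling_Suc_le[of k "m + j"] assms by simp
  also have "\<dots> \<le> (m + Suc j + k\<^sup>2) * ((m + Suc j + k\<^sup>2) ^ j * stirling m k)"
    using Suc by (intro mult_mono order_trans[OF Suc] mult_right_mono power_mono) auto
  finally show ?case by (simp add: algebra_simps)
qed simp

text \<open>Following only the second summand of the recurrence amounts to prescribing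
  \<open>k - 1\<close> fixed points and counting the cycles through all remaining points. The loss
  is of order m^k, which the exponentially small remainder of the approximation can afford.\<close>

lemma stirling_ge_fact:
  assumes "1 \<le> k" "k \<le> m" shows "fact (m - k) \<le> stirling m k"
  using assms
proof (induction k arbitrary: m)
  case (Suc k)
  then obtain l where l: "m = Suc l" by (cases m) auto
  show ?case
  proof (cases "k = 0")
    case True
    then show ?thesis using l by (simp add: stirling_Suc_n_1 del: stirling.simps)
  next
    case False
    then have "fact (l - k) \<le> stirling l k" using Suc l by simp
    then show ?thesis using l by simp
  qed
qed simp

section \<open>Permutations that avoid a given permutation\<close>

text \<open>This is truncated inclusion-exclusion for a single permutation with \<open>m\<close>
  agreements. For positive \<open>m\<close> the truncated sum telescopes to the binomial coefficient
  of \<open>m - 1\<close> and \<open>J\<close> with sign (-1)^J, which is negative or zero for odd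
  \<open>J\<close>.\<close>

lemma bonferroni_lower_bound:
  assumes "odd J"
  shows "(\<Sum>j\<le>J. (-1) ^ j * real (m choose j)) \<le> (if m = 0 then 1 else 0)"
proof (cases m)
  case 0
  have "(\<Sum>j\<le>J. (-1) ^ j * real (0 choose j)) = (\<Sum>j\<in>{0}. (-1) ^ j * real (0 choose j))"
    by (rule sum.mono_neutral_right) auto
  then show ?thesis using 0 by simp
next
  case (Suc l)
  have "(\<Sum>j\<le>J. (-1) ^ j * real (m choose j)) = (\<Sum>j\<le>J. (real m gchoose j) * (- 1) ^ j)"
    by (simp add: binomial_gbinomial mult.commute)
  also have "\<dots> = (-1) ^ J * (real m - 1 gchoose J)" by (rule gbinomial_sum_lower_neg)
  also have "\<dots> = - real (l choose J)" using assms Suc by (simp add: binomial_gbinomial)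
  finally show ?thesis using Suc by simp
qed

lemma sum_choose_agreements:
  assumes "finite V"
  shows "(\<Sum>\<tau>\<in>cycle_perms V k. card {p \<in> V. \<tau> p = \<rho> p} choose j)
       = (\<Sum>D\<in>{D. D \<subseteq> V \<and> card D = j}. card (agreeing V k D \<rho>))"
proof -
  let ?Ds = "{D. D \<subseteq> V \<and> card D = j}"
  have fin: "finite ?Ds" using assms by simp
  have "card {p \<in> V. \<tau> p = \<rho> p} choose j = (\<Sum>D\<in>?Ds. if \<forall>p\<in>D. \<tau> p = \<rho> p then 1 else 0)" for \<tau>
  proof -
    have "card {p \<in> V. \<tau> p = \<rho> p} choose j = card {D. D \<subseteq> {p \<in> V. \<tau> p = \<rho> p} \<and> card D = j}"
      using assms by (simp add: n_subsets)
    also have "{D. D \<subseteq> {p \<in> V. \<tau> p = \<rho> p} \<and> card D = j} = {D \<in> ?Ds. \<forall>p\<in>D. \<tau> p = \<rho> p}" by auto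
    finally show ?thesis using fin by (simp add: sum.If_cases Int_def)
  qed
  then have "(\<Sum>\<tau>\<in>cycle_perms V k. card {p \<in> V. \<tau> p = \<rho> p} choose j)
      = (\<Sum>D\<in>?Ds. \<Sum>\<tau>\<in>cycle_perms V k. if \<forall>p\<in>D. \<tau> p = \<rho> p then 1 else 0)"
    by (simp add: sum.swap[of _ _ "cycle_perms V k"])
  also have "\<dots> = (\<Sum>D\<in>?Ds. card (agreeing V k D \<rho>))"
    using finite_cycle_perms[OF assms] by (simp add: sum.If_cases agreeing_def Int_def)
  finally show ?thesis .
qed

text \<open>A set of at most \<open>J\<close> arcs can contain a whole cycle only if it starts at
  one of these points. There are few of them because each short cycle supplies at most
  \<open>J\<close>.\<close>

lemma card_points_on_short_cycles:
  assumes "finite V" "\<rho> permutes V"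
  shows "card {p \<in> V. card (orbit \<rho> p) \<le> J} \<le> J * cycles_on V \<rho>"
proof -
  let ?O = "{C \<in> orbit \<rho> ` V. card C \<le> J}"
  have "{p \<in> V. card (orbit \<rho> p) \<le> J} \<subseteq> \<Union>?O"
    using permutes_self_in_orbit[OF assms] by blast
  moreover have "C \<subseteq> V" if "C \<in> ?O" for C
    using that permutes_orbit_subset[OF assms(2)] by blast
  then have "finite (\<Union>?O)" using assms(1) by (meson Sup_least finite_subset)
  ultimately have "card {p \<in> V. card (orbit \<rho> p) \<le> J} \<le> card (\<Union>?O)" by (intro card_mono)
  also have "\<dots> \<le> (\<Sum>C\<in>?O. card C)" by (rule card_Union_le_sum_card)
  also have "\<dots> \<le> (\<Sum>C\<in>?O. J)" by (rule sum_mono) auto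
  also have "\<dots> = J * card ?O" by simp
  also have "\<dots> \<le> J * card (orbit \<rho> ` V)" using assms(1) by (intro mult_left_mono card_mono) auto
  finally show ?thesis by (simp add: cycles_on_def)
qed

lemma card_subsets_meeting_le:
  assumes "finite V" "P \<subseteq> V" "j \<ge> 1"
  shows "card {D. D \<subseteq> V \<and> card D = j \<and> D \<inter> P \<noteq> {}} \<le> card P * card V ^ (j - 1)"
proof -
  let ?E = "{E. E \<subseteq> V \<and> card E = j - 1}"
  have fP: "finite P" using assms finite_subset by blast
  have "{D. D \<subseteq> V \<and> card D = j \<and> D \<inter> P \<noteq> {}} \<subseteq> (\<Union>p\<in>P. insert p ` ?E)"
  proof
    fix D assume "D \<in> {D. D \<subseteq> V \<and> card D = j \<and> D \<inter> P \<noteq> {}}"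
    then obtain p where D: "D \<subseteq> V" "card D = j" "p \<in> D" "p \<in> P" by auto
    then have "D = insert p (D - {p})" "D - {p} \<in> ?E" by auto
    then show "D \<in> (\<Union>p\<in>P. insert p ` ?E)" using D by blast
  qed
  then have "card {D. D \<subseteq> V \<and> card D = j \<and> D \<inter> P \<noteq> {}} \<le> card (\<Union>p\<in>P. insert p ` ?E)"
    using fP assms by (intro card_mono) auto
  also have "\<dots> \<le> (\<Sum>p\<in>P. card (insert p ` ?E))" using fP by (rule card_UN_le)
  also have "\<dots> \<le> (\<Sum>p\<in>P. card V ^ (j - 1))"
  proof (rule sum_mono)
    fix p
    have "card (insert p ` ?E) \<le> card V choose (j - 1)"
      using card_image_le[of ?E "insert p"] assms(1) by (simp add: n_subsets)
    also have "\<dots> \<le> card V ^ (j - 1)"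
      using binomial_le_pow[of "j - 1" "card V"] by (cases "j - 1 \<le> card V") (auto simp: binomial_eq_0)
    finally show "card (insert p ` ?E) \<le> card V ^ (j - 1)" .
  qed
  finally show ?thesis by simp
qed

text \<open>Crude bound for the exceptional \<open>D\<close> that may close cycles: each arc closes
  at most one cycle, and each lost cycle costs at most the square of \<open>k\<close>.\<close>

lemma card_agreeing_le:
  assumes "finite V" "\<rho> permutes V" "D \<subseteq> V" "1 \<le> k" "k + card D \<le> card V"
  shows "card (agreeing V k D \<rho>) \<le> (k\<^sup>2) ^ card D * stirling (card V - card D) k"
proof -
  obtain c where c: "c \<le> card D" "card (agreeing V k D \<rho>) =
      (if c \<le> k then stirling (card V - card D) (k - c) else 0)"
    using card_agreeing[OF assms(1-3)] by metis
  show ?thesis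
  proof (cases "c \<le> k")
    case True
    then have "card (agreeing V k D \<rho>) \<le> (k\<^sup>2) ^ c * stirling (card V - card D) k"
      using c stirling_diff_le[of c k "card V - card D"] assms(5) by simp
    also have "\<dots> \<le> (k\<^sup>2) ^ card D * stirling (card V - card D) k"
      using c assms(4) by (intro mult_right_mono power_increasing) auto
    finally show ?thesis .
  qed (use c in simp)
qed

text \<open>The number of agreements with \<open>\<rho>\<close> has nearly the factorial moments of
  a Poisson variable of mean 1. There are about m^j / j! sets \<open>D\<close>, and almost all of
  them avoid short cycles and contribute exactly \<open>stirling (m - j) k\<close>, about m^(-j)
  times \<open>stirling m k\<close>. One \<open>\<eta>\<close> of the error pays for the sets that
  meet a short cycle, the other for these two approximations.\<close>

lemma agreement_moment_bound:
  fixes \<eta> :: real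
  assumes V: "finite V" "\<rho> permutes V" "card V = m" "cycles_on V \<rho> \<le> K"
    and k: "1 \<le> k" "k + J \<le> m" and j: "j \<le> J" and \<eta>: "0 \<le> \<eta>" "\<eta> \<le> 1"
    and up: "real m ^ j \<le> (1 + \<eta>) * real (m - J) ^ j"
    and low: "(1 - \<eta>) * real (m + k\<^sup>2) ^ j \<le> real (m - J) ^ j"
    and err: "real (2 * J * K * k ^ (2 * J)) \<le> \<eta> * real m"
  shows "\<bar>real (\<Sum>D\<in>{D. D \<subseteq> V \<and> card D = j}. card (agreeing V k D \<rho>))
           - real (stirling m k) / fact j\<bar> \<le> 2 * \<eta> * real (stirling m k)"
proof -
  define P where "P = {p \<in> V. card (orbit \<rho> p) \<le> J}"
  define Ds where "Ds = {D. D \<subseteq> V \<and> card D = j}"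
  define Bd where "Bd = {D. D \<subseteq> V \<and> card D = j \<and> D \<inter> P \<noteq> {}}"
  define a where "a = real (stirling (m - j) k)"
  define s where "s = real (stirling m k)"
  define N where "N D = real (card (agreeing V k D \<rho>))" for D
  have fin: "finite Ds" "finite Bd" "Bd \<subseteq> Ds" using V(1) by (auto simp: Ds_def Bd_def)
  have mJ: "0 < m - J" "0 < m" using k by auto
  have a0: "0 \<le> a" and s0: "0 \<le> s" by (auto simp: a_def s_def)
  have good: "N D = a" if "D \<in> Ds - Bd" for D
  proof -
    have D: "D \<subseteq> V" "card D = j" "D \<inter> P = {}" using that by (auto simp: Ds_def Bd_def)
    have no: "\<not> orbit \<rho> x \<subseteq> D" if "x \<in> D" for x
    proof
      assume "orbit \<rho> x \<subseteq> D"
      then have "card (orbit \<rho> x) \<le> J" using D V(1) j card_mono[of D "orbit \<rho> x"] finite_subset by fastforce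
      then show False using D \<open>x \<in> D\<close> by (auto simp: P_def)
    qed
    obtain c where "card (agreeing V k D \<rho>) = (if c \<le> k then stirling (card V - card D) (k - c) else 0)"
      "c \<noteq> 0 \<longrightarrow> (\<exists>x\<in>D. orbit \<rho> x \<subseteq> D)"
      using card_agreeing[OF V(1,2) D(1)] by metis
    then show ?thesis using no D V(3) by (simp add: N_def a_def)
  qed
  have k1: "1 \<le> real k ^ (2 * j)" using k by simp
  have bad: "\<bar>N D - a\<bar> \<le> real k ^ (2 * j) * a" if "D \<in> Bd" for D
  proof -
    have D: "D \<subseteq> V" "card D = j" using that by (auto simp: Bd_def)
    have "card (agreeing V k D \<rho>) \<le> (k\<^sup>2) ^ card D * stirling (card V - card D) k"
      using card_agreeing_le[OF V(1,2) D(1) k(1)] D k j V(3) by simp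
    then have "N D \<le> real ((k\<^sup>2) ^ j * stirling (m - j) k)"
      unfolding N_def using D V(3) by (metis of_nat_mono)
    then have "N D \<le> real k ^ (2 * j) * a" by (simp add: a_def power_mult)
    moreover have "a \<le> real k ^ (2 * j) * a" using mult_right_mono[OF k1 a0] by simp
    moreover have "0 \<le> N D" by (simp add: N_def)
    ultimately show ?thesis using a0 by linarith
  qed
  \<comment> \<open>Multiplying by \<open>m\<close> avoids the exponent \<open>j - 1\<close>, which
    truncated subtraction would spoil at \<open>j = 0\<close>.\<close>
  have cBd: "real (card Bd) * real m \<le> real (J * K) * real m ^ j"
  proof (cases "j = 0")
    case True
    then have "Bd = {}" using V(1) finite_subset[of _ V] by (auto simp: Bd_def)
    then show ?thesis by simp
  next
    case False
    have "card P \<le> J * K"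
      using card_points_on_short_cycles[OF V(1,2), of J] V(4) unfolding P_def
      by (meson le_trans mult_le_mono2)
    then have "card Bd \<le> J * K * m ^ (j - 1)"
    proof -
      assume "card P \<le> J * K"
      moreover have "card Bd \<le> card P * m ^ (j - 1)"
        using card_subsets_meeting_le[OF V(1), of P j] False V(3) by (simp add: Bd_def P_def)
      ultimately show ?thesis by (meson le_trans mult_le_mono1)
    qed
    then have "card Bd * m \<le> J * K * m ^ (j - 1) * m" by (rule mult_right_mono) simp
    also have "\<dots> = J * K * m ^ j" using False by (cases j) simp_all
    finally show ?thesis by (metis of_nat_mono of_nat_mult of_nat_power)
  qed
  have s_a: "real (m - j) ^ j * a \<le> s" "s \<le> real (m + k\<^sup>2) ^ j * a"
  proof -
    have "(m - j) ^ j * stirling (m - j) k \<le> stirling m k"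
      using stirling_shift_ge[of "m - j" j k] j k by simp
    then show "real (m - j) ^ j * a \<le> s" unfolding a_def s_def by (metis of_nat_mono of_nat_mult of_nat_power)
    have "stirling m k \<le> (m + k\<^sup>2) ^ j * stirling (m - j) k"
      using stirling_shift_le[of k "m - j" j] j k by simp
    then show "s \<le> real (m + k\<^sup>2) ^ j * a" unfolding a_def s_def by (metis of_nat_mono of_nat_mult of_nat_power)
  qed
  have aJ: "real (m - J) ^ j * a \<le> s"
  proof -
    have "real (m - J) ^ j * a \<le> real (m - j) ^ j * a"
      using j a0 by (intro mult_right_mono power_mono) auto
    then show ?thesis using s_a(1) by linarith
  qed
  have ma: "real m ^ j * a \<le> (1 + \<eta>) * s"
  proof -
    have "real m ^ j * a \<le> (1 + \<eta>) * real (m - J) ^ j * a" using up a0 by (rule mult_right_mono)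
    also have "\<dots> \<le> (1 + \<eta>) * s" using mult_left_mono[OF aJ, of "1 + \<eta>"] \<eta> by (simp add: mult.assoc)
    finally show ?thesis .
  qed
  have e1: "\<bar>(\<Sum>D\<in>Ds. N D) - real (m choose j) * a\<bar> \<le> \<eta> * s"
  proof -
    have cD: "card Ds = m choose j" using n_subsets[OF V(1)] V(3) by (simp add: Ds_def)
    have "(\<Sum>D\<in>Ds. N D) - real (m choose j) * a = (\<Sum>D\<in>Ds. N D - a)"
      by (simp add: sum_subtractf cD)
    also have "\<dots> = (\<Sum>D\<in>Bd. N D - a)"
      using good fin by (intro sum.mono_neutral_right) auto
    finally have "\<bar>(\<Sum>D\<in>Ds. N D) - real (m choose j) * a\<bar> \<le> (\<Sum>D\<in>Bd. \<bar>N D - a\<bar>)" by simp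
    also have "\<dots> \<le> (\<Sum>D\<in>Bd. real k ^ (2 * j) * a)" using bad by (rule sum_mono)
    also have "\<dots> = real (card Bd) * (real k ^ (2 * j) * a)" by simp
    finally have "\<bar>(\<Sum>D\<in>Ds. N D) - real (m choose j) * a\<bar> * m \<le> real (card Bd) * (real k ^ (2 * j) * a) * m"
      by (rule mult_right_mono) simp
    also have "\<dots> = (real (card Bd) * m) * (real k ^ (2 * j) * a)" by simp
    also have "\<dots> \<le> (real (J * K) * real m ^ j) * (real k ^ (2 * j) * a)"
      using cBd a0 by (intro mult_right_mono) auto
    also have "\<dots> \<le> (real (J * K) * real m ^ j) * (real k ^ (2 * J) * a)"
      using k j a0 by (intro mult_left_mono mult_right_mono power_increasing) auto
    also have "\<dots> = (real (J * K) * real k ^ (2 * J)) * (real m ^ j * a)" by simp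
    \<comment> \<open>The factor 2 inside \<open>err\<close> is kept to absorb
      \<open>1 + \<eta> \<le> 2\<close>.\<close>
    also have "\<dots> \<le> (\<eta> * m / 2) * ((1 + \<eta>) * s)"
    proof (rule mult_mono)
      show "real (J * K) * real k ^ (2 * J) \<le> \<eta> * m / 2" using err by simp
    qed (use ma a0 \<eta> in auto)
    also have "\<dots> \<le> (\<eta> * m / 2) * (2 * s)"
      using \<eta> s0 by (intro mult_left_mono mult_right_mono) auto
    finally show ?thesis using mJ by (simp add: mult.assoc mult.left_commute)
  qed
  have fj: "1 \<le> (fact j :: real)" by (rule fact_ge_1)
  have bin: "real (m choose j) * fact j \<le> real m ^ j" "real (m - J) ^ j \<le> real (m choose j) * fact j"
  proof -
    have jm: "j \<le> m" using j k by simp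
    have eq: "real (m choose j) * fact j = (\<Prod>i<j. real m - real i)"
      by (simp add: binomial_gbinomial gbinomial_prod_rev atLeast0LessThan)
    have "(\<Prod>i<j. real m - real i) \<le> (\<Prod>i<j. real m)"
      using jm by (intro prod_mono) auto
    then show "real (m choose j) * fact j \<le> real m ^ j" unfolding eq by simp
    have "(\<Prod>i<j. real (m - J)) \<le> (\<Prod>i<j. real m - real i)"
      using jm j k by (intro prod_mono) (auto simp: of_nat_diff)
    then show "real (m - J) ^ j \<le> real (m choose j) * fact j" unfolding eq by simp
  qed
  have "real (m choose j) * fact j * a \<le> (1 + \<eta>) * s"
    using mult_right_mono[OF bin(1) a0] ma by simp
  moreover have "(1 - \<eta>) * s \<le> real (m choose j) * fact j * a"
  proof -
    have "(1 - \<eta>) * s \<le> (1 - \<eta>) * (real (m + k\<^sup>2) ^ j * a)"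
      using s_a(2) \<eta> by (intro mult_left_mono) auto
    also have "\<dots> \<le> real (m - J) ^ j * a" using mult_right_mono[OF low a0] by (simp add: mult.assoc)
    also have "\<dots> \<le> real (m choose j) * fact j * a" by (rule mult_right_mono[OF bin(2) a0])
    finally show ?thesis .
  qed
  ultimately have "\<bar>real (m choose j) * fact j * a - s\<bar> \<le> \<eta> * s" by (simp add: algebra_simps abs_le_iff)
  then have "\<bar>real (m choose j) * fact j * a - s\<bar> / fact j \<le> \<eta> * s / 1"
    using fj \<eta> s0 by (intro frac_le) auto
  moreover have "\<bar>real (m choose j) * fact j * a - s\<bar> / fact j = \<bar>real (m choose j) * a - s / fact j\<bar>"
  proof -
    have "real (m choose j) * a - s / fact j = (real (m choose j) * fact j * a - s) / fact j"
      by (simp add: field_simps)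
    then show ?thesis by (simp add: abs_divide)
  qed
  ultimately have "\<bar>real (m choose j) * a - s / fact j\<bar> \<le> \<eta> * s" by simp
  then have "\<bar>(\<Sum>D\<in>Ds. N D) - s / fact j\<bar> \<le> 2 * \<eta> * s" using e1 by linarith
  then show ?thesis by (simp add: N_def Ds_def s_def)
qed

text \<open>Each of the \<open>J + 1\<close> moments in the Bonferroni sum is off by at most
  \<open>2 * \<eta>\<close> relative to \<open>stirling m k\<close>, whence the correction term. The
  bound \<open>K\<close> on the cycles of \<open>\<rho>\<close> is separate from \<open>k\<close>,
  since \<open>\<rho>\<close> will arise by contraction and may have more cycles than the
  permutations counted.\<close>

lemma card_derangements_ge:
  fixes \<eta> :: real
  assumes V: "finite V" "\<rho> permutes V" "card V = m" "cycles_on V \<rho> \<le> K"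
    and k: "1 \<le> k" "k + J \<le> m" and "odd J" and \<eta>: "0 \<le> \<eta>" "\<eta> \<le> 1"
    and up: "\<And>j. j \<le> J \<Longrightarrow> real m ^ j \<le> (1 + \<eta>) * real (m - J) ^ j"
    and low: "\<And>j. j \<le> J \<Longrightarrow> (1 - \<eta>) * real (m + k\<^sup>2) ^ j \<le> real (m - J) ^ j"
    and err: "real (2 * J * K * k ^ (2 * J)) \<le> \<eta> * real m"
  shows "real (stirling m k) * ((\<Sum>j\<le>J. (-1) ^ j / fact j) - 2 * (real J + 1) * \<eta>)
           \<le> real (card {\<tau> \<in> cycle_perms V k. \<forall>p\<in>V. \<tau> p \<noteq> \<rho> p})"
proof -
  define s where "s = real (stirling m k)"
  define A where "A \<tau> = card {p \<in> V. \<tau> p = \<rho> p}" for \<tau>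
  define T where "T j = real (\<Sum>D\<in>{D. D \<subseteq> V \<and> card D = j}. card (agreeing V k D \<rho>))" for j
  have T: "\<bar>T j - s / fact j\<bar> \<le> 2 * \<eta> * s" if "j \<le> J" for j
    unfolding T_def s_def
    by (rule agreement_moment_bound[OF V k that \<eta> up[OF that] low[OF that] err])
  have "s * ((\<Sum>j\<le>J. (-1) ^ j / fact j) - 2 * (real J + 1) * \<eta>)
      = (\<Sum>j\<le>J. (-1) ^ j * (s / fact j) - 2 * \<eta> * s)"
    by (simp add: sum_subtractf sum_distrib_left algebra_simps)
  also have "\<dots> \<le> (\<Sum>j\<le>J. (-1) ^ j * T j)"
  proof (rule sum_mono)
    fix j assume "j \<in> {..J}"
    then have "\<bar>T j - s / fact j\<bar> \<le> 2 * \<eta> * s" using T by simp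
    then show "(-1) ^ j * (s / fact j) - 2 * \<eta> * s \<le> (-1) ^ j * T j"
      by (cases "even j") (simp_all add: abs_le_iff)
  qed
  also have "\<dots> = (\<Sum>j\<le>J. \<Sum>\<tau>\<in>cycle_perms V k. (-1) ^ j * real (A \<tau> choose j))"
    unfolding T_def sum_choose_agreements[OF V(1), symmetric] A_def
    by (simp add: sum_distrib_left)
  also have "\<dots> = (\<Sum>\<tau>\<in>cycle_perms V k. \<Sum>j\<le>J. (-1) ^ j * real (A \<tau> choose j))"
    by (rule sum.swap)
  also have "\<dots> \<le> (\<Sum>\<tau>\<in>cycle_perms V k. if A \<tau> = 0 then 1 else 0)"
    by (intro sum_mono bonferroni_lower_bound assms)
  also have "\<dots> = real (card {\<tau> \<in> cycle_perms V k. A \<tau> = 0})"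
    using finite_cycle_perms[OF V(1)] by (simp add: sum.If_cases Int_def)
  also have "{\<tau> \<in> cycle_perms V k. A \<tau> = 0} = {\<tau> \<in> cycle_perms V k. \<forall>p\<in>V. \<tau> p \<noteq> \<rho> p}"
    using V(1) by (auto simp: A_def)
  finally show ?thesis unfolding s_def .
qed

section \<open>Spread families\<close>

text \<open>A uniformly random member contains a given finite \<open>X\<close> with probability at
  most r^(-|X|). The multiplied-out form makes sense for the empty family too.\<close>

definition spread :: "real \<Rightarrow> 'a set set \<Rightarrow> bool" where
  "spread r G \<longleftrightarrow> (\<forall>X. finite X \<longrightarrow> r ^ card X * card {S \<in> G. X \<subseteq> S} \<le> card G)"

definition colourings :: "'a set \<Rightarrow> ('a \<Rightarrow> nat) set" where
  "colourings U = U \<rightarrow>\<^sub>E {0..<4}"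

definition colour_class :: "'a set \<Rightarrow> ('a \<Rightarrow> nat) \<Rightarrow> nat \<Rightarrow> 'a set" where
  "colour_class U f a = {x \<in> U. f x = a}"

text \<open>The fragment \<open>S' - W\<close> may come from a member other than \<open>S\<close>,
  but it has to lie inside \<open>S\<close>. Therefore sets contained in fragments are contained in
  members, and spreadness of \<open>G\<close> controls how often fragments overlap.\<close>

definition reducible :: "'a set set \<Rightarrow> nat \<Rightarrow> 'a set \<Rightarrow> 'a set \<Rightarrow> bool" where
  "reducible G w W S \<longleftrightarrow> (\<exists>S'\<in>G. S' - W \<subseteq> S \<and> card (S' - W) \<le> w)"

lemma finite_colourings: "finite U \<Longrightarrow> finite (colourings U)"
  by (simp add: colourings_def finite_PiE)

lemma card_colourings: "finite U \<Longrightarrow> card (colourings U) = 4 ^ card U"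
  by (simp add: colourings_def card_PiE)

text \<open>Given that class \<open>a\<close> is exactly \<open>W\<close>, each other point has
  three colours left, so all of \<open>T\<close> gets colour \<open>b\<close> with conditional
  probability 3^(-|T|).\<close>

lemma card_colourings_prescribed:
  assumes "finite U" "W \<subseteq> U" "T \<subseteq> U - W" "a < 4" "b < 4" "a \<noteq> b"
  shows "card {f \<in> colourings U. colour_class U f a = W \<and> T \<subseteq> colour_class U f b}
          * 3 ^ card T = 3 ^ card (U - W)"
proof -
  let ?B = "\<lambda>x. if x \<in> W then {a} else if x \<in> T then {b} else {0..<4} - {a}"
  have "{f \<in> colourings U. colour_class U f a = W \<and> T \<subseteq> colour_class U f b} = PiE U ?B"
  proof (intro set_eqI iffI)
    fix f assume "f \<in> {f \<in> colourings U. colour_class U f a = W \<and> T \<subseteq> colour_class U f b}"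
    then show "f \<in> PiE U ?B"
      unfolding colourings_def colour_class_def by (auto simp: PiE_iff)
  next
    fix f assume f: "f \<in> PiE U ?B"
    have v: "f x \<in> ?B x" if "x \<in> U" for x using f that by (auto simp: PiE_iff)
    have 1: "f \<in> colourings U"
      unfolding colourings_def PiE_iff
    proof (intro conjI ballI)
      fix x assume "x \<in> U"
      from v[OF this] show "f x \<in> {0..<4}" using assms(4,5) by (auto split: if_splits)
    qed (use f in \<open>auto simp: PiE_iff\<close>)
    have 2: "f x = a \<longleftrightarrow> x \<in> W" if "x \<in> U" for x
      using v[OF that] assms(6) by (auto split: if_splits)
    have 3: "f x = b" if "x \<in> T" for x
      using v[of x] that assms(3) by (auto split: if_splits)
    show "f \<in> {f \<in> colourings U. colour_class U f a = W \<and> T \<subseteq> colour_class U f b}"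
      using 1 2 3 assms(2,3) by (auto simp: colour_class_def)
  qed
  then have "card {f \<in> colourings U. colour_class U f a = W \<and> T \<subseteq> colour_class U f b}
      = (\<Prod>x\<in>U. card (?B x))" using assms(1) by (simp add: card_PiE)
  also have "\<dots> = (\<Prod>x\<in>U. if x \<in> U - W - T then 3 else 1)"
    using assms(4) by (intro prod.cong) auto
  also have "\<dots> = 3 ^ card (U - W - T)"
  proof -
    have "U \<inter> {x. x \<in> U - W - T} = U - W - T" by auto
    then show ?thesis using assms(1) by (simp only: prod.If_cases) simp
  qed
  finally have "card {f \<in> colourings U. colour_class U f a = W \<and> T \<subseteq> colour_class U f b}
      * 3 ^ card T = 3 ^ (card (U - W - T) + card T)" by (simp add: power_add)
  also have "card (U - W - T) + card T = card (U - W)"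
    using assms(1,3) by (metis card_Diff_subset card_mono finite_Diff finite_subset le_add_diff_inverse2)
  finally show ?thesis .
qed

lemma card_colourings_off:
  assumes "finite U" "S \<subseteq> U"
  shows "card {f \<in> colourings U. \<forall>x\<in>U - S. f x = g x} \<le> 4 ^ card S"
proof -
  let ?B = "\<lambda>x. if x \<in> S then {0..<4::nat} else {g x}"
  have "{f \<in> colourings U. \<forall>x\<in>U - S. f x = g x} \<subseteq> PiE U ?B"
    by (auto simp: colourings_def PiE_iff extensional_def)
  then have "card {f \<in> colourings U. \<forall>x\<in>U - S. f x = g x} \<le> card (PiE U ?B)"
    using assms(1) by (intro card_mono finite_PiE) auto
  also have "\<dots> = (\<Prod>x\<in>U. if x \<in> S then 4 else 1)"
    using assms(1) by (simp add: card_PiE) (intro prod.cong; simp)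
  also have "\<dots> = 4 ^ card S"
    using assms by (simp add: prod.If_cases Int_absorb1)
  finally show ?thesis .
qed

text \<open>Union bound over the subsets of \<open>C\<close> with more than \<open>w\<close>
  elements, of which there are at most 2^|C|; each lies in a proportion of at most r^(-w) of the
  members.\<close>

lemma card_large_intersection_le:
  assumes "spread r G" "finite G" "1 \<le> r" "finite C"
  shows "real (card {S \<in> G. w < card (S \<inter> C)}) * r ^ w \<le> 2 ^ card C * card G"
proof -
  have fS: "finite {S \<in> G. P S}" for P using assms(2) by simp
  have "{S \<in> G. w < card (S \<inter> C)} \<subseteq> (\<Union>X\<in>{X \<in> Pow C. w < card X}. {S \<in> G. X \<subseteq> S})"
    by blast
  then have "card {S \<in> G. w < card (S \<inter> C)} \<le> (\<Sum>X\<in>{X \<in> Pow C. w < card X}. card {S \<in> G. X \<subseteq> S})"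
    using assms(2,4) by (intro order_trans[OF card_mono card_UN_le]) auto
  then have "real (card {S \<in> G. w < card (S \<inter> C)}) * r ^ w
      \<le> (\<Sum>X\<in>{X \<in> Pow C. w < card X}. real (card {S \<in> G. X \<subseteq> S})) * r ^ w"
    using assms(3) by (intro mult_right_mono) (auto simp flip: of_nat_sum)
  also have "\<dots> = (\<Sum>X\<in>{X \<in> Pow C. w < card X}. r ^ w * real (card {S \<in> G. X \<subseteq> S}))"
    by (simp add: sum_distrib_left mult.commute)
  also have "\<dots> \<le> (\<Sum>X\<in>{X \<in> Pow C. w < card X}. real (card G))"
  proof (rule sum_mono)
    fix X assume X: "X \<in> {X \<in> Pow C. w < card X}"
    then have "r ^ w * real (card {S \<in> G. X \<subseteq> S}) \<le> r ^ card X * real (card {S \<in> G. X \<subseteq> S})"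
      using assms(3) by (intro mult_right_mono power_increasing) auto
    also have "\<dots> \<le> card G"
      using assms(1,4) X unfolding spread_def by (auto dest: finite_subset)
    finally show "r ^ w * real (card {S \<in> G. X \<subseteq> S}) \<le> card G" .
  qed
  also have "\<dots> = real (card {X \<in> Pow C. w < card X}) * card G" by simp
  also have "\<dots> \<le> real (card (Pow C)) * card G"
    using assms(4) by (intro mult_right_mono of_nat_mono card_mono) auto
  finally show ?thesis using assms(4) by (simp add: card_Pow)
qed

text \<open>Encode a bad pair \<open>(f, S)\<close> by the colouring \<open>f'\<close> obtained by giving all of \<open>S\<close> colour \<open>a\<close>:
  a member \<open>C\<close> of \<open>G\<close> chosen from \<open>f'\<close> alone meets \<open>S\<close> in more than \<open>w\<close> points, which is rare by
  spreadness.\<close>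

lemma sum_irreducible_le:
  assumes U: "finite U" "\<And>S. S \<in> G \<Longrightarrow> S \<subseteq> U \<and> card S \<le> n"
    and G: "spread r G" "1 \<le> r" and a: "a < 4"
  shows "(\<Sum>f\<in>colourings U. real (card {S \<in> G. \<not> reducible G w (colour_class U f a) S})) * r ^ w
           \<le> 8 ^ n * real (card (colourings U)) * real (card G)"
proof -
  let ?\<Omega> = "colourings U"
  have fG: "finite G" using U by (meson Pow_iff finite_Pow_iff finite_subset subsetI)
  have f\<Omega>: "finite ?\<Omega>" using U(1) by (rule finite_colourings)
  \<comment> \<open>The choice depends on the colouring alone. This makes the encoding useful: for a
    fixed new colouring, \<open>S\<close> has to meet a fixed set.\<close>
  define C where "C f = (SOME C. C \<in> G \<and> C \<subseteq> colour_class U f a)" for f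
  define re where "re f S = (\<lambda>x. if x \<in> S then a else f x)" for f :: "'a \<Rightarrow> nat" and S
  \<comment> \<open>The existence clause guards the choice in \<open>C f\<close>, which is arbitrary
    if no member lies in the class.\<close>
  define Q where "Q f = {S \<in> G. \<exists>S'\<in>G. S' \<subseteq> colour_class U f a \<and> w < card (S \<inter> C f)}" for f
  define Bd where "Bd = (SIGMA f:?\<Omega>. {S \<in> G. \<not> reducible G w (colour_class U f a) S})"
  define R where "R f' S = {f \<in> ?\<Omega>. \<forall>x\<in>U - S. f x = f' x}" for f' :: "'a \<Rightarrow> nat" and S
  have Csp: "C f \<in> G \<and> C f \<subseteq> colour_class U f a" if "S' \<in> G" "S' \<subseteq> colour_class U f a" for S' f
    unfolding C_def by (rule someI[of _ S']) (use that in simp)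
  have "Bd \<subseteq> (\<lambda>((f', S), f). (f, S)) ` (SIGMA p:(SIGMA f':?\<Omega>. Q f'). R (fst p) (snd p))"
  proof
    fix p assume "p \<in> Bd"
    then obtain f S where p: "p = (f, S)" "f \<in> ?\<Omega>" "S \<in> G" "\<not> reducible G w (colour_class U f a) S"
      by (auto simp: Bd_def)
    let ?f = "re f S"
    have SU: "S \<subseteq> U" using U(2) p(3) by auto
    have f': "?f \<in> ?\<Omega>" using p(2) a SU by (auto simp: colourings_def re_def PiE_iff extensional_def)
    have cc: "colour_class U ?f a = colour_class U f a \<union> S"
      using SU by (auto simp: colour_class_def re_def)
    have "C ?f \<in> G" "C ?f - colour_class U f a \<subseteq> S" using Csp[of S ?f] p(3) cc by auto
    then have "w < card (C ?f - colour_class U f a)"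
      using p(4) unfolding reducible_def by (meson not_le)
    also have "\<dots> \<le> card (S \<inter> C ?f)"
      using \<open>C ?f - colour_class U f a \<subseteq> S\<close> SU U(1) by (intro card_mono) (auto intro: finite_subset)
    finally have "S \<in> Q ?f" using p(3) cc by (auto simp: Q_def)
    moreover have "f \<in> R ?f S" using p(2) by (auto simp: R_def re_def)
    ultimately show "p \<in> (\<lambda>((f', S), f). (f, S)) ` (SIGMA p:(SIGMA f':?\<Omega>. Q f'). R (fst p) (snd p))"
      using f' p(1) by (intro image_eqI[of _ _ "((?f, S), f)"]) auto
  qed
  moreover have fQ: "finite (Q f)" "finite (R f S)" for f S using fG f\<Omega> by (auto simp: Q_def R_def)
  ultimately have "card Bd \<le> card (SIGMA p:(SIGMA f':?\<Omega>. Q f'). R (fst p) (snd p))"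
    using f\<Omega> by (intro surj_card_le) (auto intro!: finite_SigmaI)
  also have "\<dots> = (\<Sum>p\<in>(SIGMA f':?\<Omega>. Q f'). card (R (fst p) (snd p)))"
    using f\<Omega> fQ by (intro card_SigmaI) (auto intro!: finite_SigmaI)
  also have "\<dots> \<le> (\<Sum>p\<in>(SIGMA f':?\<Omega>. Q f'). 4 ^ n)"
  proof (rule sum_mono)
    fix p assume "p \<in> (SIGMA f':?\<Omega>. Q f')"
    then have "snd p \<in> G" by (auto simp: Q_def)
    then have "card (R (fst p) (snd p)) \<le> 4 ^ card (snd p)" "(4::nat) ^ card (snd p) \<le> 4 ^ n"
      unfolding R_def using U card_colourings_off[of U "snd p"] by (auto intro!: power_increasing)
    then show "card (R (fst p) (snd p)) \<le> 4 ^ n" by linarith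
  qed
  also have "\<dots> = 4 ^ n * (\<Sum>f'\<in>?\<Omega>. card (Q f'))"
    using f\<Omega> fQ by (simp add: card_SigmaI)
  finally have "real (card Bd) \<le> 4 ^ n * (\<Sum>f'\<in>?\<Omega>. real (card (Q f')))"
    by (metis (mono_tags, lifting) of_nat_mono of_nat_mult of_nat_numeral of_nat_power of_nat_sum sum.cong)
  then have "real (card Bd) * r ^ w \<le> 4 ^ n * (\<Sum>f'\<in>?\<Omega>. real (card (Q f'))) * r ^ w"
    using G(2) by (intro mult_right_mono) auto
  also have "\<dots> = 4 ^ n * (\<Sum>f'\<in>?\<Omega>. real (card (Q f')) * r ^ w)"
    by (simp add: sum_distrib_right mult.assoc)
  also have "\<dots> \<le> 4 ^ n * (\<Sum>f'\<in>?\<Omega>. 2 ^ n * real (card G))"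
  proof (intro mult_left_mono sum_mono)
    fix f'
    show "real (card (Q f')) * r ^ w \<le> 2 ^ n * real (card G)"
    proof (cases "\<exists>S'\<in>G. S' \<subseteq> colour_class U f' a")
      case True
      then have c: "C f' \<in> G" using Csp by blast
      then have cU: "finite (C f')" "card (C f') \<le> n" using U finite_subset by blast+
      have "real (card (Q f')) * r ^ w \<le> real (card {S \<in> G. w < card (S \<inter> C f')}) * r ^ w"
        using G(2) fG by (intro mult_right_mono of_nat_mono card_mono) (auto simp: Q_def)
      also have "\<dots> \<le> 2 ^ card (C f') * card G"
        by (rule card_large_intersection_le[OF G(1) fG G(2) cU(1)])
      also have "\<dots> \<le> 2 ^ n * real (card G)"
        using cU by (simp add: mult_right_mono power_increasing)
      finally show ?thesis .
    next
      case False
      then have "Q f' = {}" by (auto simp: Q_def)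
      then show ?thesis by simp
    qed
  qed auto
  \<comment> \<open>The factor 4^n counts the colours on \<open>S\<close> that the encoding forgets,
    the factor 2^n is the union bound over subsets of the chosen member.\<close>
  also have "\<dots> = (4 ^ n * 2 ^ n) * real (card ?\<Omega>) * real (card G)" by simp
  also have "(4::real) ^ n * 2 ^ n = 8 ^ n" using power_mult_distrib[of "4::real" 2 n] by simp
  finally have "real (card Bd) * r ^ w \<le> 8 ^ n * real (card ?\<Omega>) * real (card G)" .
  moreover have "card Bd = (\<Sum>f\<in>?\<Omega>. card {S \<in> G. \<not> reducible G w (colour_class U f a) S})"
    unfolding Bd_def using f\<Omega> fG by (intro card_SigmaI) auto
  ultimately show ?thesis by simp
qed

lemma sum_Pow_power_card:
  fixes x :: real
  assumes "finite Y" shows "(\<Sum>X\<in>Pow Y. x ^ card X) = (1 + x) ^ card Y"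
  using prod_add[OF assms, of "\<lambda>_. x" "\<lambda>_. 1"] by (simp add: add.commute)

text \<open>Second moment of the number of fragments, each weighted by \<open>3 ^ card T\<close>, that are
  monochromatic of colour \<open>b\<close>.\<close>

lemma card_reducible_le:
  assumes U: "finite U" "\<And>S. S \<in> G \<Longrightarrow> S \<subseteq> U" "W \<subseteq> U"
    and G: "spread r G" "1 \<le> r" "G \<noteq> {}" and ab: "a < 4" "b < 4" "a \<noteq> b"
  defines "\<Omega> \<equiv> {f \<in> colourings U. colour_class U f a = W}"
  shows "real (card {S \<in> G. reducible G w W S}) * real (card \<Omega>)
      \<le> (1 + 2 / r) ^ w * real (card G)
          * real (card {f \<in> \<Omega>. \<exists>S\<in>G. S \<subseteq> colour_class U f a \<union> colour_class U f b})"
proof -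
  define H where "H = {S \<in> G. reducible G w W S}"
  define T where "T S = (SOME S'. S' \<in> G \<and> S' - W \<subseteq> S \<and> card (S' - W) \<le> w) - W" for S
  define E where "E = {f \<in> \<Omega>. \<exists>S\<in>G. S \<subseteq> colour_class U f a \<union> colour_class U f b}"
  define I where "I X f = (if X \<subseteq> colour_class U f b then 1 else 0 :: real)" for X f
  define Z where "Z f = (\<Sum>S\<in>H. 3 ^ card (T S) * I (T S) f)" for f
  have fG: "finite G" using U by (intro finite_subset[of G "Pow U"]) auto
  then have fH: "finite H" by (simp add: H_def)
  have f\<Omega>: "finite \<Omega>" using finite_colourings[OF U(1)] by (simp add: \<Omega>_def)
  have T: "\<exists>S'\<in>G. T S = S' - W \<and> T S \<subseteq> S \<and> card (T S) \<le> w" if "S \<in> H" for S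
  proof -
    have "\<exists>S'. S' \<in> G \<and> S' - W \<subseteq> S \<and> card (S' - W) \<le> w"
      using that by (auto simp: H_def reducible_def)
    from someI_ex[OF this] show ?thesis unfolding T_def by auto
  qed
  have TU: "T S \<subseteq> U - W" "finite (T S)" "card (T S) \<le> w" "T S \<subseteq> S" if "S \<in> H" for S
    using T[OF that] U finite_subset[of "T S" U] by auto
  define c where "c = real (card \<Omega>)"
  have cP: "(\<Sum>f\<in>\<Omega>. I X f) * 3 ^ card X = c" if "X \<subseteq> U - W" for X
  proof -
    have e: "{f \<in> colourings U. colour_class U f a = W \<and> Y \<subseteq> colour_class U f b}
        = {f \<in> \<Omega>. Y \<subseteq> colour_class U f b}" for Y by (auto simp: \<Omega>_def)
    have "card {f \<in> \<Omega>. X \<subseteq> colour_class U f b} * 3 ^ card X = card {f \<in> \<Omega>. {} \<subseteq> colour_class U f b} * 3 ^ card ({} :: 'a set)"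
      using card_colourings_prescribed[OF U(1,3) that ab] card_colourings_prescribed[OF U(1,3) _ ab, of "{}"]
      unfolding e by simp
    then have "real (card {f \<in> \<Omega>. X \<subseteq> colour_class U f b} * 3 ^ card X) = real (card \<Omega>)" by simp
    then have "real (card {f \<in> \<Omega>. X \<subseteq> colour_class U f b}) * 3 ^ card X = c"
      by (simp add: c_def)
    then show ?thesis using f\<Omega> by (simp add: I_def sum.If_cases Int_def)
  qed
  have m1: "(\<Sum>f\<in>\<Omega>. Z f) = real (card H) * c"
  proof -
    have "(\<Sum>f\<in>\<Omega>. Z f) = (\<Sum>S\<in>H. \<Sum>f\<in>\<Omega>. 3 ^ card (T S) * I (T S) f)"
      unfolding Z_def by (rule sum.swap)
    also have "\<dots> = (\<Sum>S\<in>H. (\<Sum>f\<in>\<Omega>. I (T S) f) * 3 ^ card (T S))"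
      by (simp add: sum_distrib_right mult.commute)
    also have "\<dots> = (\<Sum>S\<in>H. c)" using cP TU by (intro sum.cong) auto
    finally show ?thesis by simp
  qed
  have r0: "0 < r" using G by simp
  \<comment> \<open>Expand 3^t as the sum of 2^|X| over the subsets \<open>X\<close> of a set of
    size t. Each \<open>X\<close> lies in a proportion of at most r^(-|X|) of the members, and the
    binomial theorem adds up the terms (2/r)^|X|.\<close>
  have inner: "(\<Sum>S'\<in>H. 3 ^ card (T S \<inter> T S')) \<le> (1 + 2 / r) ^ w * real (card G)" if S: "S \<in> H" for S
  proof -
    have "(\<Sum>S'\<in>H. 3 ^ card (T S \<inter> T S')) = (\<Sum>S'\<in>H. \<Sum>X\<in>Pow (T S). if X \<subseteq> T S' then 2 ^ card X else (0::real))"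
    proof (rule sum.cong[OF refl])
      fix S' assume "S' \<in> H"
      have "(3::real) ^ card (T S \<inter> T S') = (\<Sum>X\<in>Pow (T S \<inter> T S'). 2 ^ card X)"
        using sum_Pow_power_card[of "T S \<inter> T S'" 2] TU[OF S] by simp
      also have "\<dots> = (\<Sum>X\<in>Pow (T S) \<inter> {X. X \<subseteq> T S'}. 2 ^ card X)"
        by (rule sum.cong) auto
      finally show "(3::real) ^ card (T S \<inter> T S') = (\<Sum>X\<in>Pow (T S). if X \<subseteq> T S' then 2 ^ card X else 0)"
        using TU[OF S] by (simp add: sum.inter_restrict)
    qed
    also have "\<dots> = (\<Sum>X\<in>Pow (T S). \<Sum>S'\<in>H. if X \<subseteq> T S' then 2 ^ card X else (0::real))"
      by (rule sum.swap)
    also have "\<dots> \<le> (\<Sum>X\<in>Pow (T S). (2 / r) ^ card X * card G)"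
    proof (rule sum_mono)
      fix X assume X: "X \<in> Pow (T S)"
      have "(\<Sum>S'\<in>H. if X \<subseteq> T S' then 2 ^ card X else (0::real)) = 2 ^ card X * real (card {S' \<in> H. X \<subseteq> T S'})"
        using fH by (simp add: sum.If_cases Int_def)
      also have "\<dots> \<le> 2 ^ card X * real (card {S' \<in> G. X \<subseteq> S'})"
        using fG TU(4) by (intro mult_left_mono of_nat_mono card_mono) (auto simp: H_def)
      also have "\<dots> \<le> 2 ^ card X * (real (card G) / r ^ card X)"
      proof (intro mult_left_mono)
        have "finite X" using X TU[OF S] finite_subset by auto
        then have "r ^ card X * card {S' \<in> G. X \<subseteq> S'} \<le> card G"
          using G(1) by (auto simp: spread_def)
        then show "real (card {S' \<in> G. X \<subseteq> S'}) \<le> real (card G) / r ^ card X"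
          using r0 by (simp add: field_simps)
      qed simp
      finally show "(\<Sum>S'\<in>H. if X \<subseteq> T S' then 2 ^ card X else (0::real)) \<le> (2 / r) ^ card X * card G"
        by (simp add: power_divide)
    qed
    also have "\<dots> = (1 + 2 / r) ^ card (T S) * card G"
      using sum_Pow_power_card[of "T S" "2 / r"] TU[OF S] by (simp add: sum_distrib_right[symmetric])
    also have "\<dots> \<le> (1 + 2 / r) ^ w * real (card G)"
      using TU[OF S] r0 by (intro mult_right_mono power_increasing) auto
    finally show ?thesis .
  qed
  have m2: "(\<Sum>f\<in>\<Omega>. (Z f)\<^sup>2) \<le> real (card H) * (c * ((1 + 2 / r) ^ w * real (card G)))"
  proof -
    have "(\<Sum>f\<in>\<Omega>. (Z f)\<^sup>2) = (\<Sum>f\<in>\<Omega>. \<Sum>S\<in>H. \<Sum>S'\<in>H. (3 ^ card (T S) * 3 ^ card (T S')) * I (T S \<union> T S') f)"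
      unfolding Z_def power2_eq_square sum_product
      by (intro sum.cong refl) (auto simp: I_def)
    also have "\<dots> = (\<Sum>S\<in>H. \<Sum>S'\<in>H. \<Sum>f\<in>\<Omega>. (3 ^ card (T S) * 3 ^ card (T S')) * I (T S \<union> T S') f)"
      by (subst sum.swap, intro sum.cong refl, rule sum.swap)
    also have "\<dots> = (\<Sum>S\<in>H. \<Sum>S'\<in>H. c * 3 ^ card (T S \<inter> T S'))"
    proof (intro sum.cong refl)
      fix S S' assume S: "S \<in> H" "S' \<in> H"
      have "card (T S) + card (T S') = card (T S \<union> T S') + card (T S \<inter> T S')"
        using TU S by (intro card_Un_Int) auto
      then have "(3::real) ^ card (T S) * 3 ^ card (T S') = 3 ^ card (T S \<union> T S') * 3 ^ card (T S \<inter> T S')"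
        by (simp flip: power_add)
      then have "(\<Sum>f\<in>\<Omega>. (3 ^ card (T S) * 3 ^ card (T S')) * I (T S \<union> T S') f)
          = ((\<Sum>f\<in>\<Omega>. I (T S \<union> T S') f) * 3 ^ card (T S \<union> T S')) * 3 ^ card (T S \<inter> T S')"
        unfolding sum_distrib_left[symmetric] by (simp add: mult_ac)
      also have "(\<Sum>f\<in>\<Omega>. I (T S \<union> T S') f) * 3 ^ card (T S \<union> T S') = c"
        using TU S by (intro cP) auto
      finally show "(\<Sum>f\<in>\<Omega>. (3 ^ card (T S) * 3 ^ card (T S')) * I (T S \<union> T S') f) = c * 3 ^ card (T S \<inter> T S')" .
    qed
    also have "\<dots> = (\<Sum>S\<in>H. c * (\<Sum>S'\<in>H. 3 ^ card (T S \<inter> T S')))" by (simp add: sum_distrib_left)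
    also have "\<dots> \<le> (\<Sum>S\<in>H. c * ((1 + 2 / r) ^ w * real (card G)))"
      by (intro sum_mono mult_left_mono inner) (auto simp: c_def)
    finally show ?thesis by simp
  qed
  \<comment> \<open>If a fragment \<open>S' - W\<close> has colour \<open>b\<close>, then
    \<open>S'\<close> is covered by the classes \<open>a\<close> and \<open>b\<close>. So
    \<open>Z\<close> lives on \<open>E\<close>, and Cauchy-Schwarz on \<open>E\<close> turns the two
    moments into a lower bound for the size of \<open>E\<close>.\<close>
  have Z0: "Z f = 0" if "f \<in> \<Omega> - E" for f
    unfolding Z_def
  proof (rule sum.neutral, rule ballI)
    fix S assume S: "S \<in> H"
    obtain S' where S': "S' \<in> G" "T S = S' - W" using T[OF S] by auto
    have "colour_class U f a = W" using that by (simp add: \<Omega>_def)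
    then have "\<not> T S \<subseteq> colour_class U f b" using that S' unfolding E_def by blast
    then show "3 ^ card (T S) * I (T S) f = 0" by (simp add: I_def)
  qed
  have "(real (card H) * c)\<^sup>2 = (\<Sum>f\<in>E. Z f)\<^sup>2"
    unfolding m1[symmetric] using Z0 f\<Omega> by (subst sum.mono_neutral_right[of \<Omega> E]) (auto simp: E_def)
  also have "\<dots> \<le> (\<Sum>f\<in>E. (Z f)\<^sup>2) * real (card E)"
    by (rule sum_squared_le_sum_of_squares)
  also have "\<dots> \<le> (\<Sum>f\<in>\<Omega>. (Z f)\<^sup>2) * real (card E)"
    using f\<Omega> by (intro mult_right_mono sum_mono2) (auto simp: E_def)
  also have "\<dots> \<le> (real (card H) * (c * ((1 + 2 / r) ^ w * real (card G)))) * real (card E)"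
    using m2 by (intro mult_right_mono) auto
  finally have *: "(real (card H) * c) * (real (card H) * c)
      \<le> (real (card H) * c) * ((1 + 2 / r) ^ w * real (card G) * real (card E))"
    by (simp add: power2_eq_square mult_ac)
  have "real (card H) * c \<le> (1 + 2 / r) ^ w * real (card G) * real (card E)"
  proof (cases "real (card H) * c = 0")
    case True
    show ?thesis unfolding True using r0 by simp
  next
    case False
    then have "0 < real (card H) * c" by (simp add: c_def)
    then show ?thesis using * mult_le_cancel_left_pos by blast
  qed
  then show ?thesis by (simp only: H_def c_def E_def)
qed

text \<open>Average over the class of colour \<open>a\<close>. Irreducible pairs are at most 1/100
  of all pairs, and the second moment loses a factor of at most 9/8, so the good colourings have
  proportion at least (99/100)/(9/8) = 22/25. The constants have slack: any proportion above 1/2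
  serves the next lemma.\<close>

lemma card_two_coloured_gt:
  assumes U: "finite U" "\<And>S. S \<in> G \<Longrightarrow> S \<subseteq> U \<and> card S \<le> n"
    and G: "spread r G" "1 \<le> r" "G \<noteq> {}" and ab: "a < 4" "b < 4" "a \<noteq> b"
    and w: "100 * 8 ^ n \<le> r ^ w" "(1 + 2 / r) ^ w \<le> 9 / 8"
  shows "card (colourings U)
    < 2 * card {f \<in> colourings U. \<exists>S\<in>G. S \<subseteq> colour_class U f a \<union> colour_class U f b}"
proof -
  let ?\<Omega> = "colourings U"
  define E where "E = {f \<in> ?\<Omega>. \<exists>S\<in>G. S \<subseteq> colour_class U f a \<union> colour_class U f b}"
  define g where "g W = real (card {S \<in> G. reducible G w W S})" for W
  have fG: "finite G" using U by (intro finite_subset[of G "Pow U"]) auto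
  have f\<Omega>: "finite ?\<Omega>" using U(1) by (rule finite_colourings)
  have cG: "0 < real (card G)" using fG G(3) by (simp add: card_gt_0_iff)
  have c\<Omega>: "0 < real (card ?\<Omega>)" using card_colourings[OF U(1)] by simp
  \<comment> \<open>Conditioning on the class of colour \<open>a\<close>.\<close>
  have grp: "(\<Sum>W\<in>Pow U. \<Sum>f\<in>{f \<in> A. colour_class U f a = W}. h f) = (\<Sum>f\<in>A. h f)"
    if "A \<subseteq> ?\<Omega>" for A and h :: "_ \<Rightarrow> real"
    using that f\<Omega> U(1) by (intro sum.group) (auto simp: colour_class_def finite_subset)
  have "(\<Sum>f\<in>?\<Omega>. g (colour_class U f a))
      = (\<Sum>W\<in>Pow U. \<Sum>f\<in>{f \<in> ?\<Omega>. colour_class U f a = W}. g (colour_class U f a))"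
    by (rule grp[symmetric]) simp
  also have "\<dots> = (\<Sum>W\<in>Pow U. g W * real (card {f \<in> ?\<Omega>. colour_class U f a = W}))"
    by (intro sum.cong) (auto simp: mult.commute)
  also have "\<dots> \<le> (\<Sum>W\<in>Pow U. 9 / 8 * real (card G) * real (card {f \<in> E. colour_class U f a = W}))"
  proof (rule sum_mono)
    fix W assume "W \<in> Pow U"
    then have "g W * real (card {f \<in> ?\<Omega>. colour_class U f a = W})
        \<le> (1 + 2 / r) ^ w * real (card G) * real (card {f \<in> {f \<in> ?\<Omega>. colour_class U f a = W}.
            \<exists>S\<in>G. S \<subseteq> colour_class U f a \<union> colour_class U f b})"
      unfolding g_def using U by (intro card_reducible_le[OF U(1) _ _ G ab]) auto
    also have "{f \<in> {f \<in> ?\<Omega>. colour_class U f a = W}. \<exists>S\<in>G. S \<subseteq> colour_class U f a \<union> colour_class U f b}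
        = {f \<in> E. colour_class U f a = W}" by (auto simp: E_def)
    also have "(1 + 2 / r) ^ w * real (card G) * real (card {f \<in> E. colour_class U f a = W})
        \<le> 9 / 8 * real (card G) * real (card {f \<in> E. colour_class U f a = W})"
      using w(2) by (intro mult_right_mono) auto
    finally show "g W * real (card {f \<in> ?\<Omega>. colour_class U f a = W})
        \<le> 9 / 8 * real (card G) * real (card {f \<in> E. colour_class U f a = W})" .
  qed
  also have "\<dots> = 9 / 8 * real (card G) * (\<Sum>W\<in>Pow U. real (card {f \<in> E. colour_class U f a = W}))"
    by (simp only: sum_distrib_left)
  also have "(\<Sum>W\<in>Pow U. real (card {f \<in> E. colour_class U f a = W})) = real (card E)"
    using grp[of E "\<lambda>_. 1"] by (simp add: E_def)
  finally have up: "(\<Sum>f\<in>?\<Omega>. g (colour_class U f a)) \<le> 9 / 8 * real (card G) * real (card E)" .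
  define B where "B = (\<Sum>f\<in>?\<Omega>. real (card {S \<in> G. \<not> reducible G w (colour_class U f a) S}))"
  have "B * r ^ w \<le> 8 ^ n * real (card ?\<Omega>) * real (card G)"
    unfolding B_def by (rule sum_irreducible_le[OF U G(1,2) ab(1)])
  moreover have "B * (100 * 8 ^ n) \<le> B * r ^ w" using w(1) by (intro mult_left_mono) (auto simp: B_def intro: sum_nonneg)
  ultimately have "B * (100 * 8 ^ n) \<le> 8 ^ n * real (card ?\<Omega>) * real (card G)" by linarith
  then have "(100 * B) * 8 ^ n \<le> (real (card ?\<Omega>) * real (card G)) * 8 ^ n"
    by (simp only: mult_ac)
  then have B: "100 * B \<le> real (card ?\<Omega>) * real (card G)"
    by (rule mult_right_le_imp_le) simp
  have "B + (\<Sum>f\<in>?\<Omega>. g (colour_class U f a)) = (\<Sum>f\<in>?\<Omega>. real (card G))"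
    unfolding B_def sum.distrib[symmetric]
  proof (rule sum.cong[OF refl])
    fix f
    have "card {S \<in> G. \<not> reducible G w (colour_class U f a) S} + card {S \<in> G. reducible G w (colour_class U f a) S}
        = card ({S \<in> G. \<not> reducible G w (colour_class U f a) S} \<union> {S \<in> G. reducible G w (colour_class U f a) S})"
      using fG by (intro card_Un_disjoint[symmetric]) auto
    also have "{S \<in> G. \<not> reducible G w (colour_class U f a) S} \<union> {S \<in> G. reducible G w (colour_class U f a) S} = G"
      by auto
    finally show "real (card {S \<in> G. \<not> reducible G w (colour_class U f a) S}) + g (colour_class U f a) = real (card G)"
      unfolding g_def by linarith
  qed
  then have "B + (\<Sum>f\<in>?\<Omega>. g (colour_class U f a)) = real (card ?\<Omega>) * real (card G)" by simp
  then have "99 / 100 * (real (card ?\<Omega>) * real (card G)) \<le> 9 / 8 * real (card G) * real (card E)"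
    using up B by linarith
  then have "(99 / 100 * real (card ?\<Omega>)) * real (card G) \<le> (9 / 8 * real (card E)) * real (card G)"
    by (simp only: mult_ac)
  then have "99 / 100 * real (card ?\<Omega>) \<le> 9 / 8 * real (card E)"
    using cG by (rule mult_right_le_imp_le)
  then have "real (card ?\<Omega>) < 2 * real (card E)" using c\<Omega> by linarith
  then show ?thesis unfolding E_def by linarith
qed

text \<open>Two events, each satisfied by more than half of the colourings, share a colouring. There
  a member of \<open>G\<close> uses only colours 0 and 1, a member of \<open>H\<close> only 2 and
  3.\<close>

lemma spread_families_disjoint_members:
  assumes U: "finite U" "\<And>S. S \<in> G \<union> H \<Longrightarrow> S \<subseteq> U \<and> card S \<le> n"
    and G: "spread r G" "G \<noteq> {}" and H: "spread r H" "H \<noteq> {}" and r: "1 \<le> r"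
    and w: "100 * 8 ^ n \<le> r ^ w" "(1 + 2 / r) ^ w \<le> 9 / 8"
  shows "\<exists>S\<in>G. \<exists>T\<in>H. S \<inter> T = {}"
proof -
  let ?A = "\<lambda>G a b. {f \<in> colourings U. \<exists>S\<in>G. S \<subseteq> colour_class U f a \<union> colour_class U f b}"
  have f\<Omega>: "finite (colourings U)" using U(1) by (rule finite_colourings)
  have "card (colourings U) < 2 * card (?A G 0 1)"
    by (rule card_two_coloured_gt[OF U(1) _ G(1) r G(2) _ _ _ w]) (use U in auto)
  moreover have "card (colourings U) < 2 * card (?A H 2 3)"
    by (rule card_two_coloured_gt[OF U(1) _ H(1) r H(2) _ _ _ w]) (use U in auto)
  moreover have "card (?A G 0 1 \<union> ?A H 2 3) \<le> card (colourings U)"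
    using f\<Omega> by (intro card_mono) auto
  moreover have "card (?A G 0 1) + card (?A H 2 3) = card (?A G 0 1 \<union> ?A H 2 3) + card (?A G 0 1 \<inter> ?A H 2 3)"
    using f\<Omega> by (intro card_Un_Int) auto
  ultimately have "card (?A G 0 1 \<inter> ?A H 2 3) \<noteq> 0" by linarith
  then have "?A G 0 1 \<inter> ?A H 2 3 \<noteq> {}" by (metis card.empty)
  then obtain f S T where "S \<in> G" "S \<subseteq> colour_class U f 0 \<union> colour_class U f 1"
    "T \<in> H" "T \<subseteq> colour_class U f 2 \<union> colour_class U f 3" by blast
  moreover have "(colour_class U f 0 \<union> colour_class U f 1) \<inter> (colour_class U f 2 \<union> colour_class U f 3) = {}"
    by (auto simp: colour_class_def)
  ultimately show ?thesis by blast
qed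

section \<open>Links of spread families and their greedy removal\<close>

text \<open>A union bound over \<open>A\<close> shows that at most half of the members meet
  \<open>A\<close>. Losing half of the family is paid for by halving \<open>r\<close>, since 2^|X|
  is at least 2 for nonempty \<open>X\<close>.\<close>

lemma spread_avoiding:
  assumes "spread r G" "finite G" "finite A" "0 < r" "2 * real (card A) \<le> r"
  shows "card G \<le> 2 * card {S \<in> G. S \<inter> A = {}}" and "spread (r / 2) {S \<in> G. S \<inter> A = {}}"
proof -
  let ?G = "{S \<in> G. S \<inter> A = {}}"
  have "G \<subseteq> ?G \<union> (\<Union>y\<in>A. {S \<in> G. {y} \<subseteq> S})" by auto
  then have "card G \<le> card (?G \<union> (\<Union>y\<in>A. {S \<in> G. {y} \<subseteq> S}))"
    using assms(2,3) by (intro card_mono) auto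
  also have "\<dots> \<le> card ?G + (\<Sum>y\<in>A. card {S \<in> G. {y} \<subseteq> S})"
    using card_UN_le[OF assms(3), of "\<lambda>y. {S \<in> G. {y} \<subseteq> S}"] card_Un_le[of ?G "\<Union>y\<in>A. {S \<in> G. {y} \<subseteq> S}"]
    by linarith
  finally have "real (card G) \<le> real (card ?G + (\<Sum>y\<in>A. card {S \<in> G. {y} \<subseteq> S}))"
    by (rule of_nat_mono)
  then have c: "real (card G) \<le> real (card ?G) + (\<Sum>y\<in>A. real (card {S \<in> G. {y} \<subseteq> S}))"
    by (simp only: of_nat_add of_nat_sum)
  have y: "real (card {S \<in> G. {y} \<subseteq> S}) \<le> card G / r" for y
  proof -
    have "r ^ card {y} * real (card {S \<in> G. {y} \<subseteq> S}) \<le> card G"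
      using assms(1) unfolding spread_def by (metis finite.emptyI finite.insertI)
    then show ?thesis using assms(4) by (simp add: field_simps)
  qed
  have "(\<Sum>y\<in>A. real (card {S \<in> G. {y} \<subseteq> S})) \<le> (\<Sum>y\<in>A. card G / r)"
    by (rule sum_mono[OF y])
  also have "\<dots> = (2 * real (card A)) * card G / (2 * r)" by simp
  also have "\<dots> \<le> r * card G / (2 * r)"
    using assms(4,5) by (intro divide_right_mono mult_right_mono) auto
  also have "\<dots> = card G / 2" using assms(4) by simp
  finally show 1: "card G \<le> 2 * card ?G" using c by linarith
  show "spread (r / 2) ?G"
    unfolding spread_def
  proof (intro allI impI)
    fix X :: "'a set" assume X: "finite X"
    show "(r / 2) ^ card X * real (card {S \<in> ?G. X \<subseteq> S}) \<le> real (card ?G)"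
    proof (cases "card X = 0")
      case True
      then show ?thesis using X assms(2) by simp
    next
      case False
      have "(r / 2) ^ card X * real (card {S \<in> ?G. X \<subseteq> S}) \<le> (r / 2) ^ card X * real (card {S \<in> G. X \<subseteq> S})"
        using assms(2,4) by (intro mult_left_mono of_nat_mono card_mono) auto
      also have "\<dots> = (r ^ card X * real (card {S \<in> G. X \<subseteq> S})) / 2 ^ card X" by (simp add: power_divide)
      also have "\<dots> \<le> real (card G) / 2"
      proof (rule frac_le)
        show "r ^ card X * real (card {S \<in> G. X \<subseteq> S}) \<le> real (card G)"
          using assms(1) X by (simp add: spread_def)
        show "(2::real) \<le> 2 ^ card X" using False by (cases "card X") auto
      qed auto
      also have "\<dots> \<le> real (card ?G)" using 1 by linarith
      finally show ?thesis .
    qed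
  qed
qed

text \<open>Among the sets whose link is dense in the current family choose a largest one,
  \<open>X\<close>. Adding a nonempty \<open>Y\<close> destroys density, and comparing the two
  densities shows that the link at \<open>X\<close> is spread. Remove all members containing
  \<open>X\<close> and continue; once the chosen set has more than \<open>q\<close> elements, its
  density bounds what is left. The links belong to intermediate families, so only some
  \<open>K\<close> inside \<open>H\<close> is recorded; it still consists of members of
  \<open>H\<close>, which is what an intersection argument requires.\<close>

lemma spread_approximation:
  fixes H :: "'a set set"
  assumes "finite H" "\<forall>S\<in>H. finite S" "0 < r"
  shows "\<exists>H' \<B>. H' \<subseteq> H \<and> (\<forall>S\<in>H - H'. \<exists>B\<in>\<B>. B \<subseteq> S)
    \<and> (\<forall>B\<in>\<B>. finite B \<and> card B \<le> q \<and>
         (\<exists>K\<subseteq>H. K \<noteq> {} \<and> (\<forall>S\<in>K. B \<subseteq> S) \<and> spread r ((\<lambda>S. S - B) ` K)))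
    \<and> (H' = {} \<or> (\<exists>X. finite X \<and> q < card X \<and> real (card H') \<le> r ^ card X * card {S \<in> H. X \<subseteq> S}))"
  using assms(1,2)
proof (induction "card H" arbitrary: H rule: less_induct)
  case less
  let ?dense = "\<lambda>X. real (card H) \<le> r ^ card X * card {S \<in> H. X \<subseteq> S}"
  show ?case
  proof (cases "H = {}")
    case True
    then show ?thesis by (intro exI[of _ "{}"]) auto
  next
    case False
    have cH: "0 < card H" using False less.prems by (simp add: card_gt_0_iff)
    have fU: "finite (\<Union>H)" using less.prems by auto
    define \<D> where "\<D> = {X \<in> Pow (\<Union>H). ?dense X}"
    \<comment> \<open>The empty set is always dense, so a largest dense set exists.\<close>
    have "finite \<D>" "{} \<in> \<D>" using fU by (auto simp: \<D>_def)
    then have "Max (card ` \<D>) \<in> card ` \<D>" by (intro Max_in) auto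
    then obtain X where XD: "X \<in> \<D>" "card X = Max (card ` \<D>)" by auto
    then have X: "X \<subseteq> \<Union>H" "?dense X" by (auto simp: \<D>_def)
    have max: "card Y \<le> card X" if "Y \<subseteq> \<Union>H" "?dense Y" for Y
      unfolding XD(2) using \<open>finite \<D>\<close> that by (intro Max_ge) (auto simp: \<D>_def)
    have fX: "finite X" using X(1) fU finite_subset by auto
    show ?thesis
    proof (cases "q < card X")
      case True
      then have ex: "\<exists>X. finite X \<and> q < card X \<and> ?dense X" using X fX by blast
      show ?thesis by (rule exI[of _ H], rule exI[of _ "{}"], intro conjI disjI2 ex) simp_all
    next
      case q: False
      define K where "K = {S \<in> H. X \<subseteq> S}"
      have K0: "K \<noteq> {}"
      proof
        assume "K = {}"
        then have "{S \<in> H. X \<subseteq> S} = {}" by (simp only: K_def)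
        then have "card {S \<in> H. X \<subseteq> S} = 0" by (simp only: card.empty)
        then show False using X(2) cH by (simp only: mult_zero_right of_nat_0)
      qed
      have inj: "inj_on (\<lambda>S. S - X) K" by (auto simp: inj_on_def K_def)
      have fK: "finite K" using less.prems by (simp add: K_def)
      have spr: "spread r ((\<lambda>S. S - X) ` K)"
        unfolding spread_def
      proof (intro allI impI)
        fix Y :: "'a set" assume fY: "finite Y"
        let ?L = "{S \<in> (\<lambda>S. S - X) ` K. Y \<subseteq> S}"
        show "r ^ card Y * real (card ?L) \<le> real (card ((\<lambda>S. S - X) ` K))"
        proof (cases "Y = {} \<or> ?L = {}")
          case True
          then show ?thesis by (auto simp del: Collect_empty_eq)
        next
          case False
          then obtain S where S: "S \<in> K" "Y \<subseteq> S - X" by auto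
          then have disj: "X \<inter> Y = {}" and sub: "X \<union> Y \<subseteq> \<Union>H" by (auto simp: K_def)
          have cXY: "card (X \<union> Y) = card X + card Y"
            using fX fY disj by (rule card_Un_disjoint)
          then have "\<not> ?dense (X \<union> Y)" using max[OF sub] False fY by (auto simp: card_gt_0_iff)
          then have lt: "r ^ (card X + card Y) * card {S \<in> H. X \<union> Y \<subseteq> S} < card H" using cXY by simp
          have "?L \<subseteq> (\<lambda>S. S - X) ` {S \<in> H. X \<union> Y \<subseteq> S}" by (auto simp: K_def)
          then have "card ?L \<le> card {S \<in> H. X \<union> Y \<subseteq> S}"
            by (rule order_trans[OF card_mono card_image_le, rotated]) (use less.prems(1) in simp_all)
          then have "r ^ card Y * real (card ?L) \<le> r ^ card Y * real (card {S \<in> H. X \<union> Y \<subseteq> S})"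
            using assms(3) by (intro mult_left_mono) auto
          moreover have "r ^ card X * (r ^ card Y * real (card {S \<in> H. X \<union> Y \<subseteq> S})) \<le> r ^ card X * real (card K)"
            using lt X(2) by (simp add: K_def power_add mult.assoc)
          then have "r ^ card Y * real (card {S \<in> H. X \<union> Y \<subseteq> S}) \<le> real (card K)"
            by (rule mult_left_le_imp_le) (use assms(3) in simp)
          moreover have "card ((\<lambda>S. S - X) ` K) = card K" using inj by (rule card_image)
          ultimately show ?thesis by simp
        qed
      qed
      have lessH: "card (H - K) < card H"
        using K0 fK less.prems(1) by (intro psubset_card_mono) (auto simp: K_def)
      have "finite (H - K)" "\<forall>S\<in>H - K. finite S" using less.prems by auto
      from less.hyps[OF lessH this] obtain H' \<B> where I: "H' \<subseteq> H - K" "\<forall>S\<in>H - K - H'. \<exists>B\<in>\<B>. B \<subseteq> S"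
        "\<forall>B\<in>\<B>. finite B \<and> card B \<le> q \<and>
           (\<exists>K'\<subseteq>H - K. K' \<noteq> {} \<and> (\<forall>S\<in>K'. B \<subseteq> S) \<and> spread r ((\<lambda>S. S - B) ` K'))"
        "H' = {} \<or> (\<exists>X. finite X \<and> q < card X \<and> real (card H') \<le> r ^ card X * card {S \<in> H - K. X \<subseteq> S})"
        by (elim exE conjE) (rule that)
      show ?thesis
      proof (rule exI[of _ H'], rule exI[of _ "insert X \<B>"], intro conjI)
        show "H' \<subseteq> H" using I(1) by auto
        show "\<forall>S\<in>H - H'. \<exists>B\<in>insert X \<B>. B \<subseteq> S" using I(2) by (auto simp: K_def)
        have "K \<subseteq> H" "\<forall>S\<in>K. X \<subseteq> S" by (auto simp: K_def)
        then have "\<exists>K\<subseteq>H. K \<noteq> {} \<and> (\<forall>S\<in>K. X \<subseteq> S) \<and> spread r ((\<lambda>S. S - X) ` K)"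
          using K0 spr by blast
        moreover have "\<exists>K'\<subseteq>H. K' \<noteq> {} \<and> (\<forall>S\<in>K'. B \<subseteq> S) \<and> spread r ((\<lambda>S. S - B) ` K')" if B: "B \<in> \<B>" for B
        proof -
          obtain K' where "K' \<subseteq> H - K" "K' \<noteq> {}" "\<forall>S\<in>K'. B \<subseteq> S" "spread r ((\<lambda>S. S - B) ` K')"
            using bspec[OF I(3) B] by (elim conjE exE) (rule that)
          then show ?thesis by (intro exI[of _ K']) auto
        qed
        ultimately show "\<forall>B\<in>insert X \<B>. finite B \<and> card B \<le> q \<and>
          (\<exists>K\<subseteq>H. K \<noteq> {} \<and> (\<forall>S\<in>K. B \<subseteq> S) \<and> spread r ((\<lambda>S. S - B) ` K))"
          using I(3) fX q by simp
        \<comment> \<open>Links only grow when the removed members are put back, so the witness for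
          the smaller family also serves for \<open>H\<close>.\<close>
        have le: "r ^ card Y * real (card {S \<in> H - K. Y \<subseteq> S}) \<le> r ^ card Y * real (card {S \<in> H. Y \<subseteq> S})" for Y
          using less.prems(1) assms(3) by (intro mult_left_mono of_nat_mono card_mono) auto
        show "H' = {} \<or> (\<exists>X. finite X \<and> q < card X \<and> real (card H') \<le> r ^ card X * card {S \<in> H. X \<subseteq> S})"
          using I(4)
        proof (elim disjE exE conjE)
          fix Y assume "finite Y" "q < card Y" "real (card H') \<le> r ^ card Y * real (card {S \<in> H - K. Y \<subseteq> S})"
          then show ?thesis using le[of Y] by (intro disjI2 exI[of _ Y]) simp
        qed simp
      qed
    qed
  qed
qed

text \<open>Disjointness of the cores alone is not enough, as the rest of a member of
  \<open>K\<close> might meet \<open>C\<close>. Such members are discarded first, and likewise on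
  the other side; this is where \<open>r / 2\<close> comes from.\<close>

lemma spread_links_disjoint_members:
  assumes U: "finite U" "\<And>S. S \<in> K \<union> L \<Longrightarrow> S \<subseteq> U \<and> card S \<le> n"
    and K: "K \<noteq> {}" "\<forall>S\<in>K. B \<subseteq> S" "spread r ((\<lambda>S. S - B) ` K)"
    and L: "L \<noteq> {}" "\<forall>S\<in>L. C \<subseteq> S" "spread r ((\<lambda>S. S - C) ` L)"
    and BC: "B \<inter> C = {}" "2 * real (card B) \<le> r" "2 * real (card C) \<le> r"
    and r: "2 \<le> r" and w: "100 * 8 ^ n \<le> (r / 2) ^ w" "(1 + 2 / (r / 2)) ^ w \<le> 9 / 8"
  shows "\<exists>S\<in>K. \<exists>T\<in>L. S \<inter> T = {}"
proof -
  let ?G = "\<lambda>K B C. {S \<in> (\<lambda>S. S - B) ` K. S \<inter> C = {}}"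
  have fin: "finite K" "finite L" using U by (auto intro: finite_subset[of _ "Pow U"])
  have fBC: "finite B" "finite C"
  proof -
    obtain S T where "S \<in> K" "T \<in> L" using K(1) L(1) by auto
    then have "B \<subseteq> U" "C \<subseteq> U" using U(2)[of S] U(2)[of T] bspec[OF K(2), of S] bspec[OF L(2), of T] by auto
    then show "finite B" "finite C" using U(1) finite_subset by auto
  qed
  have ne: "?G K B C \<noteq> {}" if "finite K" "K \<noteq> {}" "spread r ((\<lambda>S. S - B) ` K)" "finite C" "2 * real (card C) \<le> r"
    for K and B C :: "'a set"
  proof
    assume e: "?G K B C = {}"
    have "card ((\<lambda>S. S - B) ` K) \<le> 2 * card (?G K B C)"
      using that r by (intro spread_avoiding(1)) auto
    then have "card ((\<lambda>S. S - B) ` K) = 0" unfolding e by simp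
    then show False using that by simp
  qed
  have "\<exists>S\<in>?G K B C. \<exists>T\<in>?G L C B. S \<inter> T = {}"
  proof (rule spread_families_disjoint_members[OF U(1) _ _ _ _ _ _ w])
    fix S assume "S \<in> ?G K B C \<union> ?G L C B"
    then obtain S' where "S' \<in> K \<union> L" "S \<subseteq> S'" by auto
    then show "S \<subseteq> U \<and> card S \<le> n"
    proof -
      have "S' \<subseteq> U" "card S' \<le> n" using U(2) \<open>S' \<in> K \<union> L\<close> by auto
      moreover have "card S \<le> card S'"
        using \<open>S \<subseteq> S'\<close> \<open>S' \<subseteq> U\<close> U(1) by (meson card_mono finite_subset)
      ultimately show ?thesis using \<open>S \<subseteq> S'\<close> by auto
    qed
  next
    show "spread (r / 2) (?G K B C)"
      by (rule spread_avoiding(2)) (use fin fBC K BC r in auto)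
    show "spread (r / 2) (?G L C B)"
      by (rule spread_avoiding(2)) (use fin fBC L BC r in auto)
  next
    show "?G K B C \<noteq> {}" by (rule ne) (use fin fBC K BC in auto)
    show "?G L C B \<noteq> {}" by (rule ne) (use fin fBC L BC in auto)
  qed (use r in auto)
  then obtain S' T' where ST: "S' \<in> ?G K B C" "T' \<in> ?G L C B" "S' \<inter> T' = {}" by blast
  then obtain S T where "S \<in> K" "T \<in> L" "(S - B) \<inter> C = {}" "(T - C) \<inter> B = {}" "(S - B) \<inter> (T - C) = {}"
    by blast
  moreover have "B \<subseteq> S" "C \<subseteq> T" using K(2) L(2) calculation(1,2) by auto
  ultimately have "S \<inter> T = {}" using BC(1) by blast
  then show ?thesis using \<open>S \<in> K\<close> \<open>T \<in> L\<close> by blast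
qed

section \<open>Intersecting families of permutations\<close>

lemma Sym_cycles_eq: "Sym_cycles n k = cycle_perms {1..n} k"
  by (simp add: Sym_cycles_def Sym_def cycle_perms_def num_cycles_def cycles_on_def)

lemma cycle_number_eq: "cycle_number m l = stirling m l"
  by (simp add: cycle_number_def Sym_cycles_eq card_cycle_perms)

definition graph_on :: "'a set \<Rightarrow> ('a \<Rightarrow> 'a) \<Rightarrow> ('a \<times> 'a) set" where
  "graph_on V \<sigma> = (\<lambda>p. (p, \<sigma> p)) ` V"

lemma mem_graph_on: "(p, a) \<in> graph_on V \<sigma> \<longleftrightarrow> p \<in> V \<and> \<sigma> p = a"
  by (auto simp: graph_on_def)

lemma card_graph_on: "card (graph_on V \<sigma>) = card V"
  unfolding graph_on_def by (rule card_image) (auto simp: inj_on_def)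

lemma graph_on_subset: "\<sigma> permutes V \<Longrightarrow> graph_on V \<sigma> \<subseteq> V \<times> V"
  by (auto simp: graph_on_def permutes_in_image)

lemma inj_on_graph_on: "inj_on (graph_on V) {\<sigma>. \<sigma> permutes V}"
proof (rule inj_onI)
  fix \<sigma> \<tau> assume *: "\<sigma> \<in> {\<sigma>. \<sigma> permutes V}" "\<tau> \<in> {\<sigma>. \<sigma> permutes V}" "graph_on V \<sigma> = graph_on V \<tau>"
  have "\<sigma> p = \<tau> p" for p
  proof (cases "p \<in> V")
    case True
    then have "(p, \<sigma> p) \<in> graph_on V \<tau>" using *(3) mem_graph_on by metis
    then show ?thesis by (simp add: mem_graph_on)
  next
    case False
    then have "\<sigma> p = p" "\<tau> p = p" using *(1,2) by (simp_all add: permutes_def)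
    then show ?thesis by simp
  qed
  then show "\<sigma> = \<tau>" by auto
qed

text \<open>Composition with \<open>inv \<sigma>\<close> turns agreement with
  \<open>\<sigma>\<close> on \<open>D\<close> into fixing \<open>D\<close> pointwise.\<close>

lemma card_permutations_agreeing_le:
  assumes "finite V" "\<sigma> permutes V" "D \<subseteq> V"
  shows "card {\<tau>. \<tau> permutes V \<and> (\<forall>p\<in>D. \<tau> p = \<sigma> p)} \<le> fact (card V - card D)"
proof -
  let ?A = "{\<tau>. \<tau> permutes V \<and> (\<forall>p\<in>D. \<tau> p = \<sigma> p)}"
  have bs: "bij \<sigma>" using assms(2) permutes_bij by blast
  have "inj_on (\<lambda>\<tau>. inv \<sigma> \<circ> \<tau>) ?A"
  proof (rule inj_onI)
    fix x y assume "inv \<sigma> \<circ> x = inv \<sigma> \<circ> y"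
    then have "\<sigma> \<circ> (inv \<sigma> \<circ> x) = \<sigma> \<circ> (inv \<sigma> \<circ> y)" by simp
    then show "x = y" using bs by (simp add: fun_eq_iff bij_is_surj surj_f_inv_f)
  qed
  moreover have "(\<lambda>\<tau>. inv \<sigma> \<circ> \<tau>) ` ?A \<subseteq> {\<tau>. \<tau> permutes (V - D)}"
  proof
    fix \<tau>' assume "\<tau>' \<in> (\<lambda>\<tau>. inv \<sigma> \<circ> \<tau>) ` ?A"
    then obtain \<tau> where t: "\<tau>' = inv \<sigma> \<circ> \<tau>" "\<tau> permutes V" "\<forall>p\<in>D. \<tau> p = \<sigma> p" by auto
    have "\<tau>' permutes V" unfolding t(1) by (intro permutes_compose t(2) permutes_inv assms(2))
    moreover have "\<tau>' p = p" if "p \<in> V - (V - D)" for p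
      using that t bs by (simp add: bij_is_inj)
    ultimately show "\<tau>' \<in> {\<tau>. \<tau> permutes (V - D)}"
      using permutes_superset by blast
  qed
  ultimately have "card ?A \<le> card {\<tau>. \<tau> permutes (V - D)}"
    using assms(1) by (intro card_inj_on_le finite_permutations) auto
  also have "\<dots> = fact (card V - card D)"
    using assms by (intro card_permutations) (auto simp: card_Diff_subset finite_subset)
  finally show ?thesis .
qed

text \<open>A nonempty link means that \<open>X\<close> is part of the graph of a permutation, so
  its arcs have distinct starting points. The number of cycles is disregarded here; only the
  remainder of the approximation is bounded in this way.\<close>

lemma card_graphs_containing_le:
  assumes V: "finite V" and F: "\<And>\<sigma>. \<sigma> \<in> F \<Longrightarrow> \<sigma> permutes V"
    and X: "{S \<in> graph_on V ` F. X \<subseteq> S} \<noteq> {}"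
  shows "card X \<le> card V" and "card {S \<in> graph_on V ` F. X \<subseteq> S} \<le> fact (card V - card X)"
proof -
  obtain \<sigma> where s: "\<sigma> \<in> F" "X \<subseteq> graph_on V \<sigma>" using X by auto
  have fg: "finite (graph_on V \<sigma>)" using V by (simp add: graph_on_def)
  show "card X \<le> card V" using card_mono[OF fg s(2)] by (simp add: card_graph_on)
  define D where "D = fst ` X"
  have "inj_on fst (graph_on V \<sigma>)" by (auto simp: inj_on_def graph_on_def)
  then have "inj_on fst X" using s(2) by (rule inj_on_subset)
  then have cD: "card D = card X" unfolding D_def by (rule card_image)
  have DV: "D \<subseteq> V" using s(2) by (force simp: D_def graph_on_def)
  have ag: "\<tau> p = \<sigma> p" if "X \<subseteq> graph_on V \<tau>" "p \<in> D" for \<tau> p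
  proof -
    obtain a where a: "(p, a) \<in> X" using \<open>p \<in> D\<close> by (auto simp: D_def)
    then have "(p, a) \<in> graph_on V \<tau>" "(p, a) \<in> graph_on V \<sigma>" using that(1) s(2) by auto
    then show ?thesis by (simp add: mem_graph_on)
  qed
  let ?A = "{\<tau>. \<tau> permutes V \<and> (\<forall>p\<in>D. \<tau> p = \<sigma> p)}"
  have fA: "finite ?A" by (rule finite_subset[OF _ finite_permutations[OF V]]) auto
  have "{S \<in> graph_on V ` F. X \<subseteq> S} \<subseteq> graph_on V ` ?A" using ag F by auto
  then have "card {S \<in> graph_on V ` F. X \<subseteq> S} \<le> card ?A"
    using fA by (meson card_image_le card_mono finite_imageI le_trans)
  also have "\<dots> \<le> fact (card V - card X)"
    using card_permutations_agreeing_le[OF V F[OF s(1)] DV] cD by simp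
  finally show "card {S \<in> graph_on V ` F. X \<subseteq> S} \<le> fact (card V - card X)" .
qed

text \<open>One term of the exponential series for e^s, with e at most 3.\<close>

lemma power_self_le_fact: "real s ^ s \<le> 3 ^ s * fact s"
proof -
  have "real s ^ s /\<^sub>R fact s \<le> (\<Sum>i. real s ^ i /\<^sub>R fact i)"
    using sum_le_suminf[OF summable_exp_generic[of "real s"], of "{s}"] by simp
  then have "real s ^ s / fact s \<le> exp (real s)" by (simp add: exp_def divide_inverse mult.commute)
  also have "\<dots> = exp 1 ^ s" by (simp flip: exp_of_nat_mult)
  also have "\<dots> \<le> 3 ^ s" by (intro power_mono exp_le) simp
  finally show ?thesis by (simp add: field_simps)
qed

text \<open>Prescribing s arcs costs a factor of at least (n/3)^s among all permutations. Taking r =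
  n/16 therefore leaves (3/16)^s to spare, enough for a gain of 4^s.\<close>

lemma power_times_fact_diff_le:
  assumes "s \<le> n" shows "real n ^ s * fact (n - s) \<le> 3 ^ s * fact n"
proof (cases "s = 0")
  case False
  have "(real n / real s) ^ s \<le> real (n choose s)" by (rule binomial_ge_n_over_k_pow_k[OF assms])
  then have "real n ^ s \<le> real (n choose s) * real s ^ s"
    using False by (simp add: power_divide field_simps)
  also have "\<dots> \<le> real (n choose s) * (3 ^ s * fact s)"
    by (intro mult_left_mono power_self_le_fact) simp
  finally have "real n ^ s * fact (n - s) \<le> real (n choose s) * (3 ^ s * fact s) * fact (n - s)"
    by (rule mult_right_mono) simp
  also have "\<dots> = 3 ^ s * (fact s * fact (n - s) * real (n choose s))" by (simp add: mult_ac)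
  also have "fact s * fact (n - s) * real (n choose s) = fact n"
    using binomial_fact_lemma[OF assms] by (metis of_nat_fact of_nat_mult)
  finally show ?thesis .
qed simp

section \<open>Stars and families with two common arcs\<close>

text \<open>A cycle of the product through neither \<open>a\<close> nor \<open>b\<close> never uses
  an altered arc, so it is a cycle of \<open>\<sigma>\<close>. At most two cycles pass through
  \<open>a\<close> or \<open>b\<close>.\<close>

lemma cycles_on_transpose_comp_le:
  assumes "finite V" "\<sigma> permutes V" "a \<in> V" "b \<in> V"
  shows "cycles_on V (transpose a b \<circ> \<sigma>) \<le> cycles_on V \<sigma> + 2"
proof -
  let ?s = "transpose a b \<circ> \<sigma>"
  have p: "?s permutes V" using assms by (intro permutes_compose permutes_swap_id)
  have "orbit ?s ` V \<subseteq> insert (orbit ?s a) (insert (orbit ?s b) (orbit \<sigma> ` V))"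
  proof
    fix P assume "P \<in> orbit ?s ` V"
    then obtain x where x: "x \<in> V" "P = orbit ?s x" by auto
    show "P \<in> insert (orbit ?s a) (insert (orbit ?s b) (orbit \<sigma> ` V))"
    proof (cases "a \<in> P \<or> b \<in> P")
      case True
      then show ?thesis using orbit_eq_of_mem[OF assms(1) p] x by auto
    next
      case False
      have "orbit \<sigma> x = orbit ?s x"
      proof (rule orbit_cong[OF permutes_self_in_orbit[OF assms(1) p]])
        fix y assume "y \<in> orbit ?s x"
        then have "?s y \<in> P" using x orbit.step by metis
        then have "?s y \<noteq> a" "?s y \<noteq> b" using False by auto
        then have "transpose a b (?s y) = ?s y" by (rule transpose_apply_other)
        then show "\<sigma> y = ?s y" by simp
      qed
      then show ?thesis using x by auto
    qed
  qed
  then have "card (orbit ?s ` V) \<le> card (insert (orbit ?s a) (insert (orbit ?s b) (orbit \<sigma> ` V)))"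
    using assms(1) by (intro card_mono) auto
  also have "\<dots> \<le> card (orbit \<sigma> ` V) + 2"
    using assms(1) by (simp add: card_insert_if le_SucI)
  finally show ?thesis by (simp add: cycles_on_def)
qed

text \<open>Contracting the common arc \<open>i \<mapsto> j\<close> identifies the star with permutations of \<open>V - {i}\<close>, where
  \<open>\<sigma>\<close> becomes a permutation \<open>\<rho>\<close> with almost as few cycles.\<close>

lemma card_star_meeting_le:
  fixes A :: real
  assumes V: "finite V" "i \<in> V" "j \<in> V" "card V = n" and k: "1 \<le> k" and \<sigma>: "\<sigma> \<in> cycle_perms V k" "\<sigma> i \<noteq> j"
    and A: "0 \<le> A" "A \<le> 1"
    and der: "\<And>\<rho> \<kappa>. \<rho> permutes (V - {i}) \<Longrightarrow> cycles_on (V - {i}) \<rho> \<le> k + 2 \<Longrightarrow> 1 \<le> \<kappa> \<Longrightarrow> \<kappa> \<le> k \<Longrightarrow>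
      real (stirling (n - 1) \<kappa>) * A \<le> real (card {\<tau> \<in> cycle_perms (V - {i}) \<kappa>. \<forall>p\<in>V - {i}. \<tau> p \<noteq> \<rho> p})"
  shows "real (card {\<tau> \<in> cycle_perms V k. \<tau> i = j \<and> (\<exists>p\<in>V. \<tau> p = \<sigma> p)})
      \<le> (1 - A) * real (max (stirling (n - 1) k) (stirling (n - 1) (k - 1)))"
proof -
  let ?t = "transpose i j" and ?W = "V - {i}"
  let ?S = "{\<tau> \<in> cycle_perms V k. \<tau> i = j \<and> (\<exists>p\<in>V. \<tau> p = \<sigma> p)}"
  \<comment> \<open>For \<open>i = j\<close> the fixed point is one of the \<open>k\<close> cycles;
    for \<open>i \<noteq> j\<close> the arc is contracted and \<open>k\<close> is kept.\<close>
  define \<kappa> where "\<kappa> = (if i = j then k - 1 else k)"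
  define \<sigma>' where "\<sigma>' = ?t \<circ> \<sigma>"
  define \<rho> where "\<rho> = transpose i (\<sigma>' i) \<circ> \<sigma>'"
  have fW: "finite ?W" using V by simp
  have cW: "card ?W = n - 1" using V by simp
  have sp: "\<sigma> permutes V" "cycles_on V \<sigma> = k" using \<sigma>(1) by (auto simp: cycle_perms_def)
  have tp: "?t permutes V" using V by (intro permutes_swap_id)
  have s'p: "\<sigma>' permutes V" unfolding \<sigma>'_def by (intro permutes_compose sp(1) tp)
  have s'i: "\<sigma>' i \<noteq> i" using \<sigma>(2) by (auto simp: \<sigma>'_def transpose_def)
  have rp: "\<rho> permutes ?W" unfolding \<rho>_def by (rule transpose_comp_permutes_remove[OF s'p V(2)])
  \<comment> \<open>Only the first transposition can raise the count, by at most 2; short-circuiting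
    \<open>i\<close> and deleting it leaves the count unchanged.\<close>
  have rc: "cycles_on ?W \<rho> \<le> k + 2"
  proof -
    have "cycles_on V \<rho> = Suc (cycles_on V \<sigma>')"
      unfolding \<rho>_def by (rule cycles_on_transpose_comp[OF V(1) s'p V(2) s'i])
    moreover have "cycles_on V \<rho> = Suc (cycles_on ?W \<rho>)"
    proof (rule cycles_on_fixed_point[OF V(1) _ V(2)])
      show "\<rho> permutes V" using rp by (rule permutes_subset) auto
      show "\<rho> i = i" by (simp add: \<rho>_def)
    qed
    moreover have "cycles_on V \<sigma>' \<le> k + 2"
      unfolding \<sigma>'_def using cycles_on_transpose_comp_le[OF V(1) sp(1) V(2,3)] sp(2) by simp
    ultimately show ?thesis by simp
  qed
  have star: "?t \<circ> \<tau> \<in> cycle_perms ?W \<kappa>" if t: "\<tau> \<in> cycle_perms V k" "\<tau> i = j" for \<tau>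
  proof (cases "i = j")
    case True
    then have "\<tau> \<in> cycle_perms V (Suc (k - 1))" "\<tau> i = i" using t k by auto
    then show ?thesis using cycle_perms_remove_fixed_point[OF V(1,2)] True by (simp add: \<kappa>_def)
  next
    case False
    have "\<tau> \<in> agreeing V k {i} ?t" using t by (simp add: agreeing_def)
    then have "transpose i (?t i) \<circ> \<tau> \<in> agreeing ?W k ({i} - {i}) (transpose i (?t i) \<circ> ?t)"
      using bij_betwE[OF agreeing_contract[OF V(1) tp V(2), of "{i}" k]] False by auto
    then show ?thesis using False by (simp add: \<kappa>_def agreeing_def)
  qed
  have inj: "inj_on (\<lambda>\<tau>. ?t \<circ> \<tau>) ?S"
  proof (rule inj_onI)
    fix x y assume "?t \<circ> x = ?t \<circ> y"
    then have "?t \<circ> (?t \<circ> x) = ?t \<circ> (?t \<circ> y)" by simp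
    then show "x = y" by (simp add: fun_eq_iff)
  qed
  let ?M = "{\<tau> \<in> cycle_perms ?W \<kappa>. \<exists>p\<in>?W. \<tau> p = \<rho> p}"
  have sub: "(\<lambda>\<tau>. ?t \<circ> \<tau>) ` ?S \<subseteq> ?M"
  proof
    fix \<tau>' assume "\<tau>' \<in> (\<lambda>\<tau>. ?t \<circ> \<tau>) ` ?S"
    then obtain \<tau> p where t: "\<tau>' = ?t \<circ> \<tau>" "\<tau> \<in> cycle_perms V k" "\<tau> i = j" "p \<in> V" "\<tau> p = \<sigma> p" by auto
    have t': "\<tau>' \<in> cycle_perms ?W \<kappa>" using star[OF t(2,3)] t(1) by simp
    have pW: "p \<in> ?W" using t \<sigma>(2) by auto
    have e: "\<tau>' p = \<sigma>' p" using t by (simp add: \<sigma>'_def)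
    have "\<tau>' p \<in> ?W" using t' pW permutes_in_image[of \<tau>' ?W p] by (simp add: cycle_perms_def)
    \<comment> \<open>\<open>\<rho>\<close> differs from \<open>\<sigma>'\<close> on the remaining
      points only where \<open>\<sigma>'\<close> takes the value \<open>i\<close>. An agreement with
      \<open>\<tau>'\<close>, which maps \<open>V - {i}\<close> to itself, cannot occur
      there.\<close>
    then have "\<sigma>' p \<noteq> i" using e by auto
    moreover have "\<sigma>' p \<noteq> \<sigma>' i" using permutes_inj[OF s'p] pW by (auto dest: injD)
    ultimately have "\<rho> p = \<sigma>' p" by (simp add: \<rho>_def)
    then have "\<tau>' p = \<rho> p" using e by simp
    then show "\<tau>' \<in> ?M" using t' pW by blast
  qed
  have fin: "finite (cycle_perms ?W \<kappa>)" using fW by (rule finite_cycle_perms)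
  have le: "card ?S \<le> card ?M"
    using card_inj_on_le[OF inj sub] fin by simp
  have M: "real (card ?M) \<le> (1 - A) * real (stirling (n - 1) \<kappa>)"
  \<comment> \<open>The derangement bound starts at one cycle. \<open>\<kappa> = 0\<close> means a
    star of a fixed point with \<open>k = 1\<close>; as \<open>\<sigma>\<close> moves
    \<open>i\<close>, a second point exists and the Stirling number vanishes.\<close>
  proof (cases "\<kappa> = 0")
    case True
    have "card ?M \<le> card (cycle_perms ?W \<kappa>)" using fin by (intro card_mono) auto
    then have "card ?M \<le> stirling (n - 1) \<kappa>" using card_cycle_perms[OF fW, of \<kappa>] cW by simp
    moreover have "stirling (n - 1) \<kappa> = 0"
    proof -
      have "i = j" "k = 1" using True k by (auto simp: \<kappa>_def split: if_splits)
      then have "\<sigma> i \<in> ?W" using \<sigma>(2) sp(1) V(2) by (simp add: permutes_in_image)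
      then have "0 < card ?W" using fW by (auto simp: card_gt_0_iff)
      then show ?thesis using cW True by simp
    qed
    ultimately show ?thesis by simp
  next
    case False
    let ?N = "{\<tau> \<in> cycle_perms ?W \<kappa>. \<forall>p\<in>?W. \<tau> p \<noteq> \<rho> p}"
    have "?M \<union> ?N = cycle_perms ?W \<kappa>" "?M \<inter> ?N = {}" by auto
    then have "card ?M + card ?N = stirling (n - 1) \<kappa>"
      using card_Un_disjoint[of ?M ?N] fin card_cycle_perms[OF fW, of \<kappa>] cW by simp
    then have "real (card ?M + card ?N) = real (stirling (n - 1) \<kappa>)" by (rule arg_cong)
    then have "real (card ?M) + real (card ?N) = real (stirling (n - 1) \<kappa>)" by (simp only: of_nat_add)
    moreover have "real (stirling (n - 1) \<kappa>) * A \<le> real (card ?N)"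
      by (rule der[OF rp rc]) (use False in \<open>auto simp: \<kappa>_def\<close>)
    ultimately show ?thesis by (simp add: algebra_simps)
  qed
  have "real (card ?S) \<le> (1 - A) * real (stirling (n - 1) \<kappa>)" using le M by linarith
  also have "\<dots> \<le> (1 - A) * real (max (stirling (n - 1) k) (stirling (n - 1) (k - 1)))"
    using A by (intro mult_left_mono of_nat_mono) (auto simp: \<kappa>_def)
  finally show ?thesis .
qed

text \<open>Two arcs leave \<open>n - 2\<close> points and close \<open>c\<close> of the cycles,
  \<open>c \<le> 2\<close>; the factor \<open>n - 2\<close> restores one point. The cases
  \<open>c = 0\<close> and \<open>c = 1\<close> give the two entries of the maximum, and
  \<open>c = 2\<close> is brought back to \<open>k - 1\<close> cycles at the cost of the square of
  \<open>k\<close>.\<close>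

lemma card_two_arcs_le:
  assumes V: "finite V" "card V = n" and k: "1 \<le> k" "k < n"
    and pa: "p \<in> V" "p' \<in> V" "(p, a) \<noteq> (p', a')"
  shows "(n - 2) * card {\<tau> \<in> cycle_perms V k. \<tau> p = a \<and> \<tau> p' = a'}
       \<le> k\<^sup>2 * max (stirling (n - 1) k) (stirling (n - 1) (k - 1))"
proof (cases "{\<tau> \<in> cycle_perms V k. \<tau> p = a \<and> \<tau> p' = a'} = {}")
  case False
  let ?M = "max (stirling (n - 1) k) (stirling (n - 1) (k - 1))"
  obtain \<sigma> where s: "\<sigma> \<in> cycle_perms V k" "\<sigma> p = a" "\<sigma> p' = a'" using False by auto
  have pp: "p \<noteq> p'" using s pa by auto
  have e: "{\<tau> \<in> cycle_perms V k. \<tau> p = a \<and> \<tau> p' = a'} = agreeing V k {p, p'} \<sigma>"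
    using s by (auto simp: agreeing_def)
  have sp: "\<sigma> permutes V" using s by (simp add: cycle_perms_def)
  obtain c where c: "c \<le> 2" "card (agreeing V k {p, p'} \<sigma>) = (if c \<le> k then stirling (n - 2) (k - c) else 0)"
  proof -
    have "{p, p'} \<subseteq> V" "card {p, p'} = 2" using pa pp by auto
    then show ?thesis using card_agreeing[OF V(1) sp, of "{p, p'}" k] V(2) that by metis
  qed
  have n2: "n - 1 = Suc (n - 2)" using k by simp
  have st: "(n - 2) * stirling (n - 2) l \<le> stirling (n - 1) l" for l
    unfolding n2 by (rule stirling_Suc_ge)
  have k2: "1 \<le> k\<^sup>2" using k by simp
  have M1: "stirling (n - 1) k \<le> k\<^sup>2 * ?M" "stirling (n - 1) (k - 1) \<le> k\<^sup>2 * ?M"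
    using mult_le_mono[OF k2, of "stirling (n - 1) k" ?M] mult_le_mono[OF k2, of "stirling (n - 1) (k - 1)" ?M] by auto
  have M2: "stirling (n - 1) (k - 2) \<le> k\<^sup>2 * ?M" if "2 \<le> k"
  proof -
    have "stirling (n - 1) (k - 1 - 1) \<le> (k - 1)\<^sup>2 * stirling (n - 1) (k - 1)"
      using that k by (intro stirling_pred_le_square) auto
    also have "\<dots> \<le> k\<^sup>2 * ?M" by (intro mult_le_mono power_mono) auto
    finally show ?thesis by (simp add: numeral_2_eq_2)
  qed
  consider "c = 0" | "c = 1" | "c = 2" using c(1) by linarith
  then have "(n - 2) * card (agreeing V k {p, p'} \<sigma>) \<le> k\<^sup>2 * ?M"
  proof cases
    case 1
    then show ?thesis using c(2) st[of k] M1 by simp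
  next
    case 2
    then show ?thesis using c(2) st[of "k - 1"] M1 k by simp
  next
    case 3
    then show ?thesis using c(2) st[of "k - 2"] M2 by (cases "2 \<le> k") auto
  qed
  then show ?thesis unfolding e .
next
  case True
  then show ?thesis by (simp only: card.empty mult_zero_right)
qed

section \<open>Structure of intersecting families and the bound for fixed parameters\<close>

lemma intersecting_structure:
  fixes n k q w :: nat
  defines "V \<equiv> {1..n}" and "M \<equiv> max (stirling (n - 1) k) (stirling (n - 1) (k - 1))"
  assumes F: "F \<subseteq> cycle_perms V k" "\<And>\<sigma> \<tau>. \<sigma> \<in> F \<Longrightarrow> \<tau> \<in> F \<Longrightarrow> \<exists>p\<in>V. \<sigma> p = \<tau> p"
    and k: "1 \<le> k" "k < n" and n: "32 \<le> n" and q: "32 * q \<le> n"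
    and w: "100 * 8 ^ n \<le> (real n / 32) ^ w" "(1 + 64 / real n) ^ w \<le> 9 / 8"
  shows "\<exists>F'\<subseteq>F. real (card F') * 4 ^ Suc q \<le> fact n \<and>
    (F' = F \<or> (\<exists>i\<in>V. \<exists>j\<in>V. \<forall>\<sigma>\<in>F - F'. \<sigma> i = j) \<or> (n - 2) * card (F - F') \<le> q\<^sup>2 * (k\<^sup>2 * M))"
proof -
  define r where "r = real n / 16"
  define H where "H = graph_on V ` F"
  have fV: "finite V" "card V = n" by (auto simp: V_def)
  have r: "2 \<le> r" using n by (simp add: r_def)
  have Fp: "\<sigma> permutes V" if "\<sigma> \<in> F" for \<sigma> using F(1) that by (auto simp: cycle_perms_def)
  have fF: "finite F" using F(1) finite_cycle_perms[OF fV(1)] finite_subset by blast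
  have fH: "finite H" using fF by (simp add: H_def)
  have HU: "S \<subseteq> V \<times> V \<and> card S \<le> n" if "S \<in> H" for S
    using that graph_on_subset Fp fV(2) by (auto simp: H_def card_graph_on)
  have injF: "inj_on (graph_on V) F"
    using inj_on_graph_on by (rule inj_on_subset) (use Fp in auto)
  obtain H' \<B> where HB: "H' \<subseteq> H" "\<forall>S\<in>H - H'. \<exists>B\<in>\<B>. B \<subseteq> S"
    "\<forall>B\<in>\<B>. finite B \<and> card B \<le> q \<and>
       (\<exists>K\<subseteq>H. K \<noteq> {} \<and> (\<forall>S\<in>K. B \<subseteq> S) \<and> spread r ((\<lambda>S. S - B) ` K))"
    "H' = {} \<or> (\<exists>X. finite X \<and> q < card X \<and> real (card H') \<le> r ^ card X * card {S \<in> H. X \<subseteq> S})"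
  proof -
    have fS: "\<forall>S\<in>H. finite S"
    proof
      fix S assume "S \<in> H"
      then show "finite S" using HU[of S] fV(1) by (intro finite_subset[of S "V \<times> V"]) auto
    qed
    have "0 < r" using r by simp
    from spread_approximation[OF fH fS this, of q] show ?thesis
      by (elim exE conjE) (rule that)
  qed
  define F' where "F' = {\<sigma> \<in> F. graph_on V \<sigma> \<in> H'}"
  have cF': "card F' \<le> card H'"
  proof (rule card_inj_on_le[of "graph_on V"])
    show "inj_on (graph_on V) F'" using injF by (rule inj_on_subset) (auto simp: F'_def)
  qed (use HB(1) fH finite_subset in \<open>auto simp: F'_def\<close>)
  \<comment> \<open>As \<open>4 * r = n / 4\<close>, a dense set of size s > q bounds the remainder
    times 4^s by (3/4)^s n!.\<close>
  have tail: "real (card H') * 4 ^ Suc q \<le> fact n"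
    using HB(4)
  proof
    assume "\<exists>X. finite X \<and> q < card X \<and> real (card H') \<le> r ^ card X * card {S \<in> H. X \<subseteq> S}"
    then obtain X where X: "finite X" "q < card X" "real (card H') \<le> r ^ card X * card {S \<in> H. X \<subseteq> S}" by auto
    show ?thesis
    proof (cases "{S \<in> H. X \<subseteq> S} = {}")
      case True
      then have "card {S \<in> H. X \<subseteq> S} = 0" by (simp only: card.empty)
      then have "card H' = 0" using X(3) by simp
      then show ?thesis by simp
    next
      case False
      let ?s = "card X"
      have s: "?s \<le> n" "card {S \<in> H. X \<subseteq> S} \<le> fact (n - ?s)"
        using card_graphs_containing_le[OF fV(1) Fp, of F X] False fV(2) by (simp_all add: H_def)
      have "real (card {S \<in> H. X \<subseteq> S}) \<le> fact (n - ?s)" using s(2) by (metis of_nat_fact of_nat_mono)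
      then have "real (card H') \<le> r ^ ?s * fact (n - ?s)"
        using X(3) r by (smt (verit) mult_left_mono zero_le_power)
      moreover have "(4::real) ^ Suc q \<le> 4 ^ ?s" using X(2) by (intro power_increasing) auto
      ultimately have "real (card H') * 4 ^ Suc q \<le> (r ^ ?s * fact (n - ?s)) * 4 ^ ?s"
        using r by (intro mult_mono) auto
      also have "\<dots> = (1 / 4) ^ ?s * (real n ^ ?s * fact (n - ?s))"
      proof -
        have "r ^ ?s * 4 ^ ?s = (1 / 4) ^ ?s * real n ^ ?s"
          unfolding power_mult_distrib[symmetric] by (simp add: r_def)
        then show ?thesis by (simp add: mult_ac)
      qed
      also have "\<dots> \<le> (1 / 4) ^ ?s * (3 ^ ?s * fact n)"
        by (intro mult_left_mono power_times_fact_diff_le s) simp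
      also have "\<dots> = (3 / 4) ^ ?s * fact n" by (simp add: power_divide)
      also have "\<dots> \<le> 1 * fact n" by (intro mult_right_mono power_le_one) auto
      finally show ?thesis by simp
    qed
  qed simp
  have link: "finite B" "card B \<le> q"
    "\<exists>K. K \<subseteq> H \<and> K \<noteq> {} \<and> (\<forall>S\<in>K. B \<subseteq> S) \<and> spread r ((\<lambda>S. S - B) ` K)" if B: "B \<in> \<B>" for B
    using bspec[OF HB(3) B] by simp_all
  \<comment> \<open>The case \<open>B = C\<close> is included and shows that no core is
    empty.\<close>
  have meet: "B \<inter> C \<noteq> {}" if mem: "B \<in> \<B>" "C \<in> \<B>" for B C
  proof
    assume BC: "B \<inter> C = {}"
    obtain K where K: "K \<subseteq> H" "K \<noteq> {}" "\<forall>S\<in>K. B \<subseteq> S" "spread r ((\<lambda>S. S - B) ` K)"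
      using link(3)[OF mem(1)] by (elim exE conjE) (rule that)
    obtain L where L: "L \<subseteq> H" "L \<noteq> {}" "\<forall>S\<in>L. C \<subseteq> S" "spread r ((\<lambda>S. S - C) ` L)"
      using link(3)[OF mem(2)] by (elim exE conjE) (rule that)
    have cB: "card B \<le> q" "card C \<le> q" using link(2) mem by blast+
    have q': "2 * real q \<le> r" using q by (simp add: r_def)
    have "\<exists>S\<in>K. \<exists>T\<in>L. S \<inter> T = {}"
    proof (rule spread_links_disjoint_members[OF _ _ K(2-4) L(2-4) BC _ _ r])
      show "finite (V \<times> V)" using fV by simp
      show "S \<subseteq> V \<times> V \<and> card S \<le> n" if "S \<in> K \<union> L" for S using HU K(1) L(1) that by blast
      show "2 * real (card B) \<le> r" "2 * real (card C) \<le> r" using cB q' by linarith+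
      show "100 * 8 ^ n \<le> (r / 2) ^ w" using w(1) by (simp add: r_def)
      show "(1 + 2 / (r / 2)) ^ w \<le> 9 / 8" using w(2) by (simp add: r_def)
    qed
    then obtain S T where ST: "S \<in> H" "T \<in> H" "S \<inter> T = {}" using K(1) L(1) by blast
    obtain \<sigma> where \<sigma>: "\<sigma> \<in> F" "S = graph_on V \<sigma>" using ST(1) unfolding H_def by (elim imageE) (rule that)
    obtain \<tau> where \<tau>: "\<tau> \<in> F" "T = graph_on V \<tau>" using ST(2) unfolding H_def by (elim imageE) (rule that)
    obtain p where "p \<in> V" "\<sigma> p = \<tau> p" using F(2)[OF \<sigma>(1) \<tau>(1)] by (elim bexE) (rule that)
    then have "(p, \<sigma> p) \<in> S" "(p, \<sigma> p) \<in> T" unfolding \<sigma>(2) \<tau>(2) by (simp_all add: mem_graph_on)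
    then show False using ST(3) by (metis IntI empty_iff)
  qed
  have cover: "\<exists>B\<in>\<B>. B \<subseteq> graph_on V \<sigma>" if "\<sigma> \<in> F - F'" for \<sigma>
    using that HB(2) by (auto simp: F'_def H_def)
  have BV: "B \<subseteq> V \<times> V" if B: "B \<in> \<B>" for B
  proof -
    obtain K where "K \<subseteq> H" "K \<noteq> {}" "\<forall>S\<in>K. B \<subseteq> S"
      using link(3)[OF B] by (elim exE conjE) (rule that)
    then obtain S where "S \<in> H" "B \<subseteq> S" by blast
    then show ?thesis using HU by blast
  qed
  have "F' = F \<or> (\<exists>i\<in>V. \<exists>j\<in>V. \<forall>\<sigma>\<in>F - F'. \<sigma> i = j) \<or> (n - 2) * card (F - F') \<le> q\<^sup>2 * (k\<^sup>2 * M)"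
  proof (cases "\<B> = {}")
    case True
    then have "F' = F" using cover by (auto simp: F'_def)
    then show ?thesis by simp
  next
    case False
    then obtain B where B: "B \<in> \<B>" by auto
    show ?thesis
    proof (cases "\<exists>x. \<forall>C\<in>\<B>. x \<in> C")
      case True
      then obtain i j where ij: "\<And>C. C \<in> \<B> \<Longrightarrow> (i, j) \<in> C" by auto
      then have "i \<in> V" "j \<in> V" using BV[OF B] B by auto
      moreover have "\<sigma> i = j" if s: "\<sigma> \<in> F - F'" for \<sigma>
      proof -
        obtain D where "D \<in> \<B>" "D \<subseteq> graph_on V \<sigma>" using cover[OF s] by (elim bexE) (rule that)
        then have "(i, j) \<in> graph_on V \<sigma>" using ij by (auto dest: subsetD)
        then show ?thesis by (simp add: mem_graph_on)
      qed
      ultimately show ?thesis by blast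
    next
      case False
      \<comment> \<open>No arc lies in all cores, so each \<open>x\<close> is missed by some core
        \<open>C x\<close>. The core inside a covered graph meets \<open>B\<close> in some
        \<open>x\<close> and meets \<open>C x\<close> in some \<open>y\<close> different from
        \<open>x\<close>; thus one of at most q^2 pairs of distinct arcs lies in the graph.\<close>
      then have "\<forall>x. \<exists>C. C \<in> \<B> \<and> x \<notin> C" by blast
      then obtain C where C: "\<And>x. C x \<in> \<B>" "\<And>x. x \<notin> C x" by metis
      note fin = link(1,2)
      define E where "E x y = {\<sigma> \<in> cycle_perms V k. x \<in> graph_on V \<sigma> \<and> y \<in> graph_on V \<sigma>}" for x y
      have cE: "(n - 2) * card (E x y) \<le> k\<^sup>2 * M" if "x \<in> B" "y \<in> C x" for x y
      proof -
        obtain p a p' a' where xy: "x = (p, a)" "y = (p', a')" by (metis surj_pair)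
        have "p \<in> V" "p' \<in> V" using BV[OF B] BV[OF C(1)] that xy by auto
        moreover have "(p, a) \<noteq> (p', a')" using that C(2) xy by auto
        moreover have "E x y = {\<tau> \<in> cycle_perms V k. \<tau> p = a \<and> \<tau> p' = a'}"
          using calculation(1,2) by (auto simp: E_def xy mem_graph_on)
        ultimately show ?thesis using card_two_arcs_le[OF fV k] by (simp add: M_def)
      qed
      have fE: "finite (E x y)" for x y using finite_cycle_perms[OF fV(1)] by (simp add: E_def)
      have "F - F' \<subseteq> (\<Union>x\<in>B. \<Union>y\<in>C x. E x y)"
      proof
        fix \<sigma> assume s: "\<sigma> \<in> F - F'"
        then obtain D where D: "D \<in> \<B>" "D \<subseteq> graph_on V \<sigma>" using cover by auto
        obtain x where x: "x \<in> D" "x \<in> B" using meet[OF D(1) B] by auto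
        obtain y where y: "y \<in> D" "y \<in> C x" using meet[OF D(1) C(1)] by blast
        show "\<sigma> \<in> (\<Union>x\<in>B. \<Union>y\<in>C x. E x y)" using s F(1) x y D by (auto simp: E_def)
      qed
      then have "card (F - F') \<le> card (\<Union>x\<in>B. \<Union>y\<in>C x. E x y)"
        using fin[OF B] fin[OF C(1)] fE by (intro card_mono) auto
      also have "\<dots> \<le> (\<Sum>x\<in>B. card (\<Union>y\<in>C x. E x y))" using fin[OF B] by (intro card_UN_le) auto
      also have "\<dots> \<le> (\<Sum>x\<in>B. \<Sum>y\<in>C x. card (E x y))" using fin[OF C(1)] by (intro sum_mono card_UN_le) auto
      finally have "(n - 2) * card (F - F') \<le> (n - 2) * (\<Sum>x\<in>B. \<Sum>y\<in>C x. card (E x y))"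
        by (rule mult_left_mono) simp
      also have "\<dots> = (\<Sum>x\<in>B. \<Sum>y\<in>C x. (n - 2) * card (E x y))" by (simp add: sum_distrib_left)
      also have "\<dots> \<le> (\<Sum>x\<in>B. \<Sum>y\<in>C x. k\<^sup>2 * M)" by (intro sum_mono cE)
      also have "\<dots> = (\<Sum>x\<in>B. card (C x) * (k\<^sup>2 * M))" by simp
      also have "\<dots> \<le> (\<Sum>x\<in>B. q * (k\<^sup>2 * M))" using fin(2)[OF C(1)] by (intro sum_mono mult_right_mono) auto
      also have "\<dots> = card B * (q * (k\<^sup>2 * M))" by simp
      also have "\<dots> \<le> q * (q * (k\<^sup>2 * M))" using fin(2)[OF B] by (rule mult_right_mono) simp
      finally show ?thesis by (simp add: power2_eq_square mult.assoc)
    qed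
  qed
  moreover have "real (card F') * 4 ^ Suc q \<le> fact n"
    using tail cF' by (smt (verit) mult_right_mono of_nat_mono zero_le_power)
  moreover have "F' \<subseteq> F" by (auto simp: F'_def)
  ultimately show ?thesis by blast
qed

text \<open>The uncovered part \<open>F'\<close> contributes at most \<open>\<delta>\<close> times
  \<open>M\<close> in every case. The covered part contributes a factor \<open>1 - A\<close> if it
  lies in a star and \<open>\<delta>\<close> if each member contains one of few pairs of
  arcs.\<close>

lemma noncentred_bound:
  fixes n k q w J :: nat and \<eta> \<delta> :: real
  defines "M \<equiv> max (stirling (n - 1) k) (stirling (n - 1) (k - 1))"
    and "A \<equiv> (\<Sum>j\<le>J. (-1) ^ j / fact j) - 2 * (real J + 1) * \<eta>"
  assumes F: "intersecting_family n k F" "\<not> centred_family n k F"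
    and k: "1 \<le> k" "k + J < n" and n: "32 \<le> n" and q: "32 * q \<le> n"
    and w: "100 * 8 ^ n \<le> (real n / 32) ^ w" "(1 + 64 / real n) ^ w \<le> 9 / 8"
    and J: "odd J" and \<eta>: "0 \<le> \<eta>" "\<eta> \<le> 1"
    and up: "\<And>j. j \<le> J \<Longrightarrow> real (n - 1) ^ j \<le> (1 + \<eta>) * real (n - 1 - J) ^ j"
    and low: "\<And>j. j \<le> J \<Longrightarrow> (1 - \<eta>) * real (n - 1 + k\<^sup>2) ^ j \<le> real (n - 1 - J) ^ j"
    and err: "real (2 * J * (k + 2) * k ^ (2 * J)) \<le> \<eta> * real (n - 1)"
    and A: "0 \<le> A" "A \<le> 1"
    and tail: "real n ^ Suc k \<le> \<delta> * 4 ^ Suc q" and pairs: "real (q\<^sup>2 * k\<^sup>2) \<le> \<delta> * real (n - 2)"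
  shows "real (card F) \<le> (max (1 - A) \<delta> + \<delta>) * real M"
proof -
  let ?V = "{1..n}"
  have Fc: "F \<subseteq> cycle_perms ?V k" "\<And>\<sigma> \<tau>. \<sigma> \<in> F \<Longrightarrow> \<tau> \<in> F \<Longrightarrow> \<exists>p\<in>?V. \<sigma> p = \<tau> p"
    using F(1) by (auto simp: intersecting_family_def Sym_cycles_eq)
  have kn: "k < n" using k by simp
  have fV: "finite ?V" "card ?V = n" by auto
  have fF: "finite F" using Fc(1) finite_cycle_perms[of ?V k] finite_subset by blast
  obtain F' where F': "F' \<subseteq> F" "real (card F') * 4 ^ Suc q \<le> fact n"
    "F' = F \<or> (\<exists>i\<in>?V. \<exists>j\<in>?V. \<forall>\<sigma>\<in>F - F'. \<sigma> i = j) \<or> (n - 2) * card (F - F') \<le> q\<^sup>2 * (k\<^sup>2 * M)"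
    using intersecting_structure[OF Fc k(1) kn n q w] unfolding M_def by blast
  have M0: "fact (n - 1 - k) \<le> real M"
  proof -
    have "fact (n - 1 - k) \<le> stirling (n - 1) k" using k by (intro stirling_ge_fact) auto
    also have "\<dots> \<le> M" by (simp add: M_def)
    finally show ?thesis by (metis of_nat_fact of_nat_mono)
  qed
  \<comment> \<open>This comparison of n! with a Stirling number is what \<open>tail\<close> has to
    compensate.\<close>
  have fn: "fact n \<le> real n ^ Suc k * real M"
  proof -
    have "(fact n :: real) / fact (n - Suc k) \<le> real n ^ Suc k"
      using fact_div_fact_le_pow[of "Suc k" n] kn fact_dvd[of "n - Suc k" n]
      by (metis Suc_leI diff_le_self of_nat_fact of_nat_mono of_nat_power real_of_nat_div)
    then have "fact n \<le> real n ^ Suc k * fact (n - 1 - k)" by (simp add: field_simps)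
    also have "\<dots> \<le> real n ^ Suc k * real M" using M0 by (rule mult_left_mono) simp
    finally show ?thesis .
  qed
  have "real (card F') * 4 ^ Suc q \<le> (\<delta> * real M) * 4 ^ Suc q"
  proof -
    have "real (card F') * 4 ^ Suc q \<le> real n ^ Suc k * real M" using F'(2) fn by linarith
    also have "\<dots> \<le> \<delta> * 4 ^ Suc q * real M" using tail by (rule mult_right_mono) simp
    finally show ?thesis by (simp add: mult_ac)
  qed
  then have t: "real (card F') \<le> \<delta> * real M" by (rule mult_right_le_imp_le) simp
  have c: "real (card F) = real (card F') + real (card (F - F'))"
  proof -
    have "card F = card F' + card (F - F')"
      using F'(1) fF by (simp add: card_Diff_subset finite_subset card_mono)
    then show ?thesis by simp
  qed
  have "real (card (F - F')) \<le> max (1 - A) \<delta> * real M"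
    using F'(3)
  proof (elim disjE)
    assume "F' = F"
    then show ?thesis using A by (simp add: le_max_iff_disj)
  next
    assume "\<exists>i\<in>?V. \<exists>j\<in>?V. \<forall>\<sigma>\<in>F - F'. \<sigma> i = j"
    then obtain i j where ij: "i \<in> ?V" "j \<in> ?V" "\<forall>\<sigma>\<in>F - F'. \<sigma> i = j" by auto
    \<comment> \<open>\<open>\<sigma>\<close> may well lie in the small part \<open>F'\<close>. It
      only has to belong to \<open>F\<close>, so that every member in the star meets it.\<close>
    obtain \<sigma> where s: "\<sigma> \<in> F" "\<sigma> i \<noteq> j"
      using F(2) ij(1,2) Fc(1) unfolding centred_family_def perm_star_def Sym_cycles_eq by blast
    have sF: "\<sigma> \<in> cycle_perms ?V k" using s(1) Fc(1) by auto
    have "F - F' \<subseteq> {\<tau> \<in> cycle_perms ?V k. \<tau> i = j \<and> (\<exists>p\<in>?V. \<tau> p = \<sigma> p)}"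
      using ij(3) Fc s(1) by blast
    then have "real (card (F - F')) \<le> real (card {\<tau> \<in> cycle_perms ?V k. \<tau> i = j \<and> (\<exists>p\<in>?V. \<tau> p = \<sigma> p)})"
      using finite_cycle_perms[of ?V k] by (intro of_nat_mono card_mono) auto
    also have "\<dots> \<le> (1 - A) * real M"
      unfolding M_def
    proof (rule card_star_meeting_le[OF fV(1) ij(1,2) fV(2) k(1) sF s(2) A])
      \<comment> \<open>The numerical hypotheses are stated for \<open>k\<close> and are monotone in
        it, so they cover both possible values of \<open>\<kappa>\<close>.\<close>
      fix \<rho> \<kappa> assume r: "\<rho> permutes ?V - {i}" "cycles_on (?V - {i}) \<rho> \<le> k + 2" "1 \<le> \<kappa>" "\<kappa> \<le> k"
      have fW: "finite (?V - {i})" and cW: "card (?V - {i}) = n - 1" using ij(1) by auto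
      have kJ: "\<kappa> + J \<le> n - 1" using k r(4) by simp
      show "real (stirling (n - 1) \<kappa>) * A \<le> real (card {\<tau> \<in> cycle_perms (?V - {i}) \<kappa>. \<forall>p\<in>?V - {i}. \<tau> p \<noteq> \<rho> p})"
        unfolding A_def
      proof (rule card_derangements_ge[OF fW r(1) cW r(2,3) kJ J \<eta> up])
        fix j assume j: "j \<le> J"
        have "(1 - \<eta>) * real (n - 1 + \<kappa>\<^sup>2) ^ j \<le> (1 - \<eta>) * real (n - 1 + k\<^sup>2) ^ j"
          using \<eta> r(4) by (intro mult_left_mono power_mono of_nat_mono add_left_mono) auto
        then show "(1 - \<eta>) * real (n - 1 + \<kappa>\<^sup>2) ^ j \<le> real (n - 1 - J) ^ j"
          using low[OF j] by linarith
      next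
        have "2 * J * (k + 2) * \<kappa> ^ (2 * J) \<le> 2 * J * (k + 2) * k ^ (2 * J)"
          using r(4) by (intro mult_left_mono power_mono) auto
        then show "real (2 * J * (k + 2) * \<kappa> ^ (2 * J)) \<le> \<eta> * real (n - 1)"
          using err by linarith
      qed
    qed
    also have "\<dots> \<le> max (1 - A) \<delta> * real M" by (rule mult_right_mono) auto
    finally show ?thesis .
  next
    assume "(n - 2) * card (F - F') \<le> q\<^sup>2 * (k\<^sup>2 * M)"
    then have "real ((n - 2) * card (F - F')) \<le> real (q\<^sup>2 * (k\<^sup>2 * M))" by (rule of_nat_mono)
    then have "real (n - 2) * real (card (F - F')) \<le> real (q\<^sup>2 * k\<^sup>2) * real M" by (simp add: mult.assoc)
    also have "\<dots> \<le> \<delta> * real (n - 2) * real M" using pairs by (rule mult_right_mono) simp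
    finally have "real (n - 2) * real (card (F - F')) \<le> real (n - 2) * (\<delta> * real M)" by (simp add: mult_ac)
    then have "real (card (F - F')) \<le> \<delta> * real M"
      by (rule mult_left_le_imp_le) (use n in simp)
    also have "\<dots> \<le> max (1 - A) \<delta> * real M" by (rule mult_right_mono) auto
    finally show ?thesis .
  qed
  then show ?thesis using c t by (simp add: distrib_right)
qed

section \<open>Asymptotics\<close>

lemma eventually_power_quotient_le:
  fixes f :: "nat \<Rightarrow> real"
  assumes "f \<longlonglongrightarrow> 1" "0 < \<eta>"
  shows "eventually (\<lambda>n. \<forall>j\<le>J. f n ^ j < 1 + \<eta>) sequentially"
    and "eventually (\<lambda>n. \<forall>j\<le>J. 1 - \<eta> < f n ^ j) sequentially"
proof -
  have lim: "(\<lambda>n. f n ^ j) \<longlonglongrightarrow> 1" for j using tendsto_power[OF assms(1), of j] by simp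
  have "eventually (\<lambda>n. \<forall>j\<in>{..J}. f n ^ j < 1 + \<eta>) sequentially"
    using order_tendstoD(2)[OF lim, of "1 + \<eta>"] assms(2) by (intro eventually_ball_finite) auto
  then show "eventually (\<lambda>n. \<forall>j\<le>J. f n ^ j < 1 + \<eta>) sequentially" by (rule eventually_mono) simp
  have "eventually (\<lambda>n. \<forall>j\<in>{..J}. 1 - \<eta> < f n ^ j) sequentially"
    using order_tendstoD(1)[OF lim, of "1 - \<eta>"] assms(2) by (intro eventually_ball_finite) auto
  then show "eventually (\<lambda>n. \<forall>j\<le>J. 1 - \<eta> < f n ^ j) sequentially" by (rule eventually_mono) simp
qed

lemma exp_minus_one_partial_sum:
  fixes \<epsilon> :: real
  assumes "0 < \<epsilon>"
  obtains J where "odd J" "\<bar>(\<Sum>j\<le>J. (-1) ^ j / fact j) - 1 / exp 1\<bar> < \<epsilon>"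
proof -
  have "(\<lambda>j. (-1) ^ j / fact j) sums exp (-1 :: real)"
    using exp_converges[of "-1 :: real"] by (simp add: divide_inverse mult.commute)
  then have "(\<lambda>n. \<Sum>j<n. (-1) ^ j / fact j) \<longlonglongrightarrow> 1 / exp (1 :: real)"
    by (simp add: sums_def exp_minus inverse_eq_divide)
  from LIMSEQ_D[OF this assms] obtain N where N: "\<And>n. N \<le> n \<Longrightarrow> \<bar>(\<Sum>j<n. (-1) ^ j / fact j) - 1 / exp (1 :: real)\<bar> < \<epsilon>"
    by auto
  show ?thesis
  proof (rule that)
    show "odd (2 * N + 1)" by simp
    show "\<bar>(\<Sum>j\<le>2 * N + 1. (-1) ^ j / fact j) - 1 / exp (1 :: real)\<bar> < \<epsilon>"
      using N[of "Suc (2 * N + 1)"] by (simp only: lessThan_Suc_atMost)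
  qed
qed

text \<open>The polylogarithmic bound on \<open>k\<close> enters the proof only here: what follows
  relies on a fixed power of \<open>k\<close> being at most \<open>n\<close>, uniformly in
  \<open>k\<close>.\<close>

lemma eventually_polylog_power_le:
  assumes "0 < d"
  shows "eventually (\<lambda>n. \<forall>k::nat. real k \<le> ln (real n) powr d \<longrightarrow> real k ^ P \<le> real n) sequentially"
proof -
  have "((\<lambda>x. (ln x powr d) ^ P / x) \<longlongrightarrow> 0) at_top"
    using assms by real_asymp
  then have "eventually (\<lambda>n. (ln (real n) powr d) ^ P / real n < 1) sequentially"
    using filterlim_real_sequentially by (intro order_tendstoD(2)) (auto intro: filterlim_compose)
  then show ?thesis using eventually_gt_at_top[of 0]
  proof eventually_elim
    case (elim n)
    show ?case
    proof (intro allI impI)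
      fix k :: nat assume "real k \<le> ln (real n) powr d"
      then have "real k ^ P \<le> (ln (real n) powr d) ^ P" by (intro power_mono) auto
      also have "\<dots> \<le> real n" using elim by (simp add: field_simps)
      finally show "real k ^ P \<le> real n" .
    qed
  qed
qed

section \<open>Choice of the parameters\<close>

text \<open>All conditions are on \<open>n\<close> alone. They result from replacing
  \<open>k\<close>, its square and its power \<open>2 * J + 1\<close> by the bounds n^(1/8), n^(1/4)
  and n^(1/2), and \<open>q\<close> by n^(1/4), so each is an asymptotic comparison in one
  variable.\<close>

definition large_enough :: "nat \<Rightarrow> real \<Rightarrow> real \<Rightarrow> nat \<Rightarrow> bool" where
  "large_enough J \<eta> \<delta> n \<longleftrightarrow> 32 \<le> n \<and> J + 1 < n \<and>
     real n powr (1/8) + real J < real n \<and>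
     32 * real n powr (1/4) \<le> real n \<and>
     real n powr (3/4) \<le> \<delta> * (real n - 2) \<and>
     exp ((real n powr (1/8) + 1) * ln (real n) - real n powr (1/4) * ln 4) \<le> \<delta> \<and>
     6 * real J * real n powr (1/2) \<le> \<eta> * (real n - 1) \<and>
     ln 100 + real n * ln 8 \<le> (real n / 1000 - 1) * ln (real n / 32) \<and>
     (\<forall>j\<le>J. ((real n - 1) / (real n - 1 - real J)) ^ j < 1 + \<eta>) \<and>
     (\<forall>j\<le>J. 1 - \<eta> < ((real n - 1 - real J) / (real n - 1 + real n powr (1/2))) ^ j)"

lemma eventually_large_enough:
  assumes "0 < \<eta>" "0 < \<delta>"
  shows "eventually (large_enough J \<eta> \<delta>) sequentially"
proof -
  have 1: "eventually (\<lambda>n. real n powr (1/8) + real J < real n) sequentially" by real_asymp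
  have 2: "eventually (\<lambda>n. 32 * real n powr (1/4) \<le> real n) sequentially" by real_asymp
  have 3: "eventually (\<lambda>n. real n powr (3/4) \<le> \<delta> * (real n - 2)) sequentially"
    using assms(2) by real_asymp
  have "(\<lambda>n. exp ((real n powr (1/8) + 1) * ln (real n) - real n powr (1/4) * ln 4)) \<longlonglongrightarrow> 0"
    by real_asymp
  from order_tendstoD(2)[OF this assms(2)]
  have 4: "eventually (\<lambda>n. exp ((real n powr (1/8) + 1) * ln (real n) - real n powr (1/4) * ln 4) \<le> \<delta>) sequentially"
    by (rule eventually_mono) simp
  have 5: "eventually (\<lambda>n. 6 * real J * real n powr (1/2) \<le> \<eta> * (real n - 1)) sequentially"
  proof -
    have "(\<lambda>n. 6 * real J * (real n powr (1/2) / (real n - 1))) \<longlonglongrightarrow> 6 * real J * 0"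
      by (intro tendsto_mult_left) real_asymp
    then have "eventually (\<lambda>n. 6 * real J * (real n powr (1/2) / (real n - 1)) < \<eta>) sequentially"
      using assms(1) by (intro order_tendstoD(2)) auto
    then show ?thesis using eventually_gt_at_top[of 1]
      by eventually_elim (simp add: field_simps)
  qed
  have 6: "eventually (\<lambda>n. ln 100 + real n * ln 8 \<le> (real n / 1000 - 1) * ln (real n / 32)) sequentially"
    by real_asymp
  have l7: "(\<lambda>n. (real n - 1) / (real n - 1 - real J)) \<longlonglongrightarrow> 1" by real_asymp
  have l8: "(\<lambda>n. (real n - 1 - real J) / (real n - 1 + real n powr (1/2))) \<longlonglongrightarrow> 1" by real_asymp
  show ?thesis
    using 1 2 3 4 5 6 eventually_power_quotient_le(1)[OF l7 assms(1), of J]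
      eventually_power_quotient_le(2)[OF l8 assms(1), of J]
      eventually_ge_at_top[of "32 + J + 2"]
    by eventually_elim (simp add: large_enough_def)
qed

text \<open>The exponent \<open>4 * J + 8\<close> covers two demands: at least 8 gives
  \<open>k\<close> at most n^(1/8), and at least \<open>4 * J + 2\<close> bounds the power
  \<open>2 * J + 1\<close> of \<open>k\<close> by the square root of n.\<close>

lemma large_enough_bound:
  fixes n k J :: nat and \<eta> \<delta> :: real
  defines "A \<equiv> (\<Sum>j\<le>J. (-1) ^ j / fact j) - 2 * (real J + 1) * \<eta>"
  assumes L: "large_enough J \<eta> \<delta> n" and k: "1 \<le> k" "real k ^ (4 * J + 8) \<le> real n"
    and J: "odd J" and \<eta>: "0 < \<eta>" "\<eta> \<le> 1" and A: "0 \<le> A" "A \<le> 1" and \<delta>: "0 < \<delta>"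
    and F: "intersecting_family n k F" "\<not> centred_family n k F"
  shows "real (card F) \<le> (max (1 - A) \<delta> + \<delta>) * real (max (stirling (n - 1) k) (stirling (n - 1) (k - 1)))"
proof -
  define x where "x = real n"
  \<comment> \<open>Then \<open>Suc q * ln 4\<close> outgrows n^(1/8) ln n, and q^2 k^2 is at most
    n^(3/4), which is small against n.\<close>
  define q where "q = nat \<lfloor>x powr (1/4)\<rfloor>"
  \<comment> \<open>With this \<open>w\<close> the exponent \<open>w * (64 / n)\<close> is at most
    0.064, and exp(0.064) is below 9/8; still \<open>w * ln (n / 32)\<close> outgrows
    \<open>n * ln 8\<close>.\<close>
  define w where "w = nat \<lfloor>x / 1000\<rfloor>"
  have L1: "x powr (1/8) + real J < x" and L2: "32 * x powr (1/4) \<le> x"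
    and L3: "x powr (3/4) \<le> \<delta> * (x - 2)"
    and L4: "exp ((x powr (1/8) + 1) * ln x - x powr (1/4) * ln 4) \<le> \<delta>"
    and L5: "6 * real J * x powr (1/2) \<le> \<eta> * (x - 1)"
    and L6: "ln 100 + x * ln 8 \<le> (x / 1000 - 1) * ln (x / 32)"
    and L7': "\<forall>j\<le>J. ((x - 1) / (x - 1 - real J)) ^ j < 1 + \<eta>"
    and L8': "\<forall>j\<le>J. 1 - \<eta> < ((x - 1 - real J) / (x - 1 + x powr (1/2))) ^ j"
    and n: "32 \<le> n" "J + 1 < n"
    using L[unfolded large_enough_def, folded x_def] by - (elim conjE, assumption)+
  note L7 = L7'[rule_format] and L8 = L8'[rule_format]
  have x: "0 < x" "32 \<le> x" using n by (auto simp: x_def)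
  have k1: "1 \<le> real k" using k by simp
  have pw: "real k ^ m \<le> x powr (real m / 8)" if "m \<le> 8" for m
  proof -
    have "real k ^ 8 \<le> real k ^ (4 * J + 8)" using k1 by (intro power_increasing) auto
    also have "\<dots> \<le> x" unfolding x_def by (rule k(2))
    finally have "real k ^ 8 \<le> x" .
    then have "(real k ^ 8) powr (real m / 8) \<le> x powr (real m / 8)"
      using k1 by (intro powr_mono2) auto
    moreover have "(real k ^ 8) powr (real m / 8) = real k ^ m"
    proof -
      have "real k ^ 8 = real k powr 8" using k1 by (simp add: powr_numeral)
      then have "(real k ^ 8) powr (real m / 8) = real k powr real m" by (simp only: powr_powr) simp
      then show ?thesis using k1 by (simp add: powr_realpow)
    qed
    ultimately show ?thesis by simp
  qed
  have kJ: "real k ^ (2 * J + 1) \<le> x powr (1/2)"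
  proof -
    have "(real k ^ (2 * J + 1))\<^sup>2 = real k ^ (4 * J + 2)" 
    proof -
      have "(2 * J + 1) * 2 = 4 * J + 2" by simp
      then show ?thesis by (simp only: power_mult[symmetric])
    qed
    also have "\<dots> \<le> real k ^ (4 * J + 8)" using k1 by (intro power_increasing) auto
    also have "\<dots> \<le> x" unfolding x_def by (rule k(2))
    finally have "(real k ^ (2 * J + 1))\<^sup>2 \<le> x" .
    then show ?thesis using x by (simp add: powr_half_sqrt real_le_rsqrt)
  qed
  have q: "real q \<le> x powr (1/4)" "x powr (1/4) \<le> real q + 1"
    unfolding q_def using powr_ge_zero[of x "1/4"] by linarith+
  have w: "real w \<le> x / 1000" "x / 1000 - 1 \<le> real w"
    unfolding w_def using x by linarith+
  have kJn: "k + J < n"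
  proof -
    have "real k + real J < real n" using pw[of 1] L1 by (simp add: x_def)
    then show ?thesis by linarith
  qed
  have q32: "32 * q \<le> n"
  proof -
    have "32 * real q \<le> real n" using q(1) L2 unfolding x_def by linarith
    then show ?thesis by linarith
  qed
  have w1: "100 * 8 ^ n \<le> (real n / 32) ^ w"
  proof -
    have "exp (x * ln 8) = (8::real) ^ n" by (simp add: x_def exp_of_nat_mult)
    then have "100 * 8 ^ n = exp (ln 100 + x * ln 8)" by (simp add: exp_add)
    also have "\<dots> \<le> exp ((x / 1000 - 1) * ln (x / 32))" using L6 by (rule iffD2[OF exp_le_cancel_iff])
    also have "\<dots> \<le> exp (real w * ln (x / 32))"
      using w x by (intro iffD2[OF exp_le_cancel_iff] mult_right_mono) auto
    also have "\<dots> = (x / 32) ^ w" using x by (simp add: exp_of_nat_mult)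
    finally show ?thesis by (simp add: x_def)
  qed
  have w2: "(1 + 64 / real n) ^ w \<le> 9 / 8"
  proof -
    have "(1 + 64 / x) ^ w \<le> exp (64 / x) ^ w" using x by (intro power_mono exp_ge_add_one_self) auto
    also have "\<dots> = exp (real w * (64 / x))" by (rule exp_of_nat_mult[symmetric])
    also have "\<dots> \<le> exp (64 / 1000)" using w(1) x by (simp add: field_simps)
    also have "\<dots> \<le> 1 + 64 / 1000 + (64 / 1000)\<^sup>2" by (rule exp_bound) auto
    also have "\<dots> \<le> (9 / 8 :: real)" by (simp add: power2_eq_square)
    finally show ?thesis by (simp add: x_def)
  qed
  have nJ: "real (n - 1 - J) = x - 1 - J" "real (n - 1) = x - 1" "0 < x - 1 - J"
    using n by (auto simp: x_def of_nat_diff)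
  have up: "real (n - 1) ^ j \<le> (1 + \<eta>) * real (n - 1 - J) ^ j" if "j \<le> J" for j
    using L7[OF that] nJ(3) unfolding nJ(1,2) power_divide by (simp add: divide_less_eq)
  have low: "(1 - \<eta>) * real (n - 1 + k\<^sup>2) ^ j \<le> real (n - 1 - J) ^ j" if "j \<le> J" for j
  proof -
    let ?y = "x - 1 + x powr (1/2)"
    have y: "0 < ?y" using x powr_ge_zero[of x "1/2"] by linarith
    have "(1 - \<eta>) * ?y ^ j \<le> (x - 1 - J) ^ j"
      using L8[OF that] y unfolding power_divide by (simp add: less_divide_eq)
    moreover have "real k ^ 2 \<le> x powr (1/2)"
    proof -
      have "x powr (1/4) \<le> x powr (1/2)" using x by (intro powr_mono) auto
      then show ?thesis using pw[of 2] by simp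
    qed
    then have "real (n - 1 + k\<^sup>2) \<le> ?y" using nJ(2) by simp
    then have "(1 - \<eta>) * real (n - 1 + k\<^sup>2) ^ j \<le> (1 - \<eta>) * ?y ^ j"
      using \<eta> by (intro mult_left_mono power_mono) auto
    ultimately show ?thesis unfolding nJ(1) by linarith
  qed
  have err: "real (2 * J * (k + 2) * k ^ (2 * J)) \<le> \<eta> * real (n - 1)"
  proof -
    have "2 * real J * (real k + 2) * real k ^ (2 * J) \<le> 2 * real J * (3 * real k) * real k ^ (2 * J)"
      using k1 by (intro mult_right_mono mult_left_mono) auto
    also have "\<dots> = 6 * real J * real k ^ (2 * J + 1)" by simp
    also have "\<dots> \<le> 6 * real J * x powr (1/2)" using kJ by (intro mult_left_mono) auto
    also have "\<dots> \<le> \<eta> * real (n - 1)" unfolding nJ(2) by (rule L5)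
    finally show ?thesis by (simp only: of_nat_mult of_nat_add of_nat_power of_nat_numeral)
  qed
  have tail: "real n ^ Suc k \<le> \<delta> * 4 ^ Suc q"
  proof -
    have "x ^ Suc k = exp (real (Suc k) * ln x)" 
    proof -
      have "exp (real (Suc k) * ln x) = exp (ln x) ^ Suc k" by (rule exp_of_nat_mult)
      then show ?thesis using exp_ln[OF x(1)] by metis
    qed
    also have "\<dots> \<le> exp ((x powr (1/8) + 1) * ln x)"
      using pw[of 1] x by (intro iffD2[OF exp_le_cancel_iff] mult_right_mono) auto
    also have "\<dots> = exp ((x powr (1/8) + 1) * ln x - x powr (1/4) * ln 4) * exp (x powr (1/4) * ln 4)"
      by (subst exp_add[symmetric]) simp
    also have "\<dots> \<le> \<delta> * exp (real (Suc q) * ln 4)"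
    proof (rule mult_mono[OF L4])
      show "exp (x powr (1/4) * ln 4) \<le> exp (real (Suc q) * ln 4)"
        using q(2) by (intro iffD2[OF exp_le_cancel_iff] mult_right_mono) auto
    qed (use \<delta> in auto)
    also have "exp (real (Suc q) * ln 4) = (4::real) ^ Suc q" 
    proof -
      have "exp (real (Suc q) * ln 4) = exp (ln 4 :: real) ^ Suc q" by (rule exp_of_nat_mult)
      then show ?thesis by (simp only: exp_ln zero_less_numeral)
    qed
    finally show ?thesis by (simp add: x_def)
  qed
  have pairs: "real (q\<^sup>2 * k\<^sup>2) \<le> \<delta> * real (n - 2)"
  proof -
    have "real q ^ 2 \<le> (x powr (1/4)) ^ 2" using q by (intro power_mono) auto
    also have "\<dots> = x powr (1/2)" by (simp add: power2_eq_square powr_add[symmetric])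
    finally have "real q ^ 2 * real k ^ 2 \<le> x powr (1/2) * x powr (1/4)"
      using pw[of 2] by (intro mult_mono) auto
    also have "\<dots> = x powr (3/4)" by (simp add: powr_add[symmetric])
    also have "\<dots> \<le> \<delta> * (x - 2)" by (rule L3)
    also have "x - 2 = real (n - 2)" using n by (simp add: x_def of_nat_diff)
    finally show ?thesis by simp
  qed
  show ?thesis
    unfolding A_def
    by (rule noncentred_bound[OF F k(1) kJn n(1) q32 w1 w2 J less_imp_le[OF \<eta>(1)] \<eta>(2) up low err
          A[unfolded A_def] tail pairs])
qed

theorem theorem1p4:
  fixes d \<xi> :: real
  assumes "d \<ge> 1" and "\<xi> > 0"
  shows "\<exists>N::nat. \<forall>n k :: nat. \<forall>F :: (nat \<Rightarrow> nat) set.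
           n \<ge> N \<longrightarrow> 1 \<le> k \<longrightarrow> real k \<le> ln (real n) powr d \<longrightarrow>
           intersecting_family n k F \<longrightarrow> \<not> centred_family n k F \<longrightarrow>
           real (card F) \<le> (1 - 1 / exp 1 + \<xi>)
             * real (max (cycle_number (n - 1) k) (cycle_number (n - 1) (k - 1)))"
proof -
  \<comment> \<open>The cap at 1/2 keeps \<open>A\<close> nonnegative, as 1/e is at least
    1/3.\<close>
  define \<epsilon> where "\<epsilon> = min \<xi> (1/2)"
  have \<epsilon>: "0 < \<epsilon>" "\<epsilon> \<le> \<xi>" "\<epsilon> \<le> 1/2" using assms(2) by (auto simp: \<epsilon>_def)
  obtain J where J: "odd J" "\<bar>(\<Sum>j\<le>J. (-1) ^ j / fact j) - 1 / exp 1\<bar> < \<epsilon> / 4"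
    using exp_minus_one_partial_sum[of "\<epsilon> / 4"] \<epsilon> by auto
  \<comment> \<open>Truncation and moment errors take \<open>\<epsilon> / 4\<close> each, so
    \<open>A\<close> exceeds 1/e - \<epsilon>/2; \<open>\<delta>\<close> adds another \<epsilon>/8,
    which stays below \<open>\<xi>\<close> in total.\<close>
  define \<eta> where "\<eta> = \<epsilon> / (8 * (real J + 1))"
  define \<delta> where "\<delta> = \<epsilon> / 8"
  define A where "A = (\<Sum>j\<le>J. (-1) ^ j / fact j) - 2 * (real J + 1) * \<eta>"
  have \<eta>: "0 < \<eta>" "\<eta> \<le> 1" using \<epsilon> by (auto simp: \<eta>_def divide_le_eq)
  have "2 * (real J + 1) * \<eta> = \<epsilon> / 4" by (simp add: \<eta>_def field_simps)
  then have A: "\<bar>A - (1 / exp 1 - \<epsilon> / 4)\<bar> < \<epsilon> / 4" using J(2) unfolding A_def by linarith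
  have e: "1 / 3 \<le> 1 / exp (1::real)" "1 / exp (1::real) \<le> 1 / 2"
    using exp_le exp_ge_add_one_self[of "1::real"] by (auto intro: frac_le)
  have A01: "0 \<le> A" "A \<le> 1" using A e \<epsilon> by linarith+
  have \<delta>: "0 < \<delta>" using \<epsilon> by (simp add: \<delta>_def)
  have le: "max (1 - A) \<delta> + \<delta> \<le> 1 - 1 / exp 1 + \<xi>"
  proof -
    have "1 - A + \<delta> \<le> 1 - 1 / exp 1 + \<xi>" "\<delta> + \<delta> \<le> 1 - 1 / exp 1 + \<xi>"
      using A e \<epsilon> unfolding \<delta>_def by linarith+
    then show ?thesis by (simp add: max_def)
  qed
  have d0: "0 < d" using assms(1) by simp
  define P where "P n \<longleftrightarrow> (\<forall>k F. 1 \<le> k \<longrightarrow> real k \<le> ln (real n) powr d \<longrightarrow>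
      intersecting_family n k F \<longrightarrow> \<not> centred_family n k F \<longrightarrow>
      real (card F) \<le> (1 - 1 / exp 1 + \<xi>)
        * real (max (cycle_number (n - 1) k) (cycle_number (n - 1) (k - 1))))" for n
  from eventually_polylog_power_le[OF d0, of "4 * J + 8"] eventually_large_enough[OF \<eta>(1) \<delta>, of J]
  have "eventually P sequentially"
  proof eventually_elim
    case (elim n)
    show ?case
      unfolding P_def
    proof (intro allI impI)
      fix k F
      assume k: "1 \<le> k" "real k \<le> ln (real n) powr d"
        and F: "intersecting_family n k F" "\<not> centred_family n k F"
      let ?M = "real (max (cycle_number (n - 1) k) (cycle_number (n - 1) (k - 1)))"
      have "real k ^ (4 * J + 8) \<le> real n" using elim(1) k(2) by blast
      then have "real (card F) \<le> (max (1 - A) \<delta> + \<delta>) * ?M"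
        unfolding A_def cycle_number_eq
        using A01 by (intro large_enough_bound[OF elim(2) k(1) _ J(1) \<eta> _ _ \<delta> F]) (simp_all add: A_def)
      also have "\<dots> \<le> (1 - 1 / exp 1 + \<xi>) * ?M" using le by (rule mult_right_mono) simp
      finally show "real (card F) \<le> (1 - 1 / exp 1 + \<xi>) * ?M" .
    qed
  qed
  then obtain N where N: "\<And>n. N \<le> n \<Longrightarrow> P n" unfolding eventually_sequentially by auto
  show ?thesis
  proof (intro exI[of _ N] allI impI)
    fix n k F
    assume "N \<le> n" and kF: "1 \<le> k" "real k \<le> ln (real n) powr d" "intersecting_family n k F" "\<not> centred_family n k F"
    from N[OF this(1), unfolded P_def, rule_format, OF kF]
    show "real (card F) \<le> (1 - 1 / exp 1 + \<xi>)
        * real (max (cycle_number (n - 1) k) (cycle_number (n - 1) (k - 1)))" .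
  qed
qed

end
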